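(* Let $T^2_2$ be the $2$-regular arboreal triangle complex, $e_0$ an edge of it, and $X_r=B_r(T^2_2,e_0)$. Then $\lim_{r\to\infty}\lambda(X_r)=\frac32-\sqrt2$, while $\lambda(T^2_2)=0$. In particular $X_r\to T^2_2$ but $\liminf_r\lambda(X_r)>\lambda(T^2_2)$.
   Context: A simplicial complex is a collection of finite subsets (cells) of a vertex set closed under taking subsets (the empty set is a cell); a $j$-cell has $j+1$ vertices; $X^j$ is the set of $j$-cells; $\deg\sigma$ is the number of $(j+1)$-cells containing the $j$-cell $\sigma$. Here $d=2$. Each edge and triangle has two orientations (vertex orderings modulo even permutations); $X^j_\pm$ is the set of oriented $j$-cells and $\bar\sigma$ the opposite orientation; an oriented triangle $[v_0,v_1,v_2]$ induces on its edges the orientations $[v_1,v_2]$, $\overline{[v_0,v_2]}=[v_2,v_0]$, $[v_0,v_1]$. $\Omega^1(X)$ is the space of real functions $f$ on oriented edges with $f(\bar e)=-f(e)$; $\Omega^0(X)$ the real functions on vertices. Two oriented edges are neighbours, $e\sim e'$, if some oriented triangle $\tau$ has both $e$ and $\overline{e'}$ as faces with the induced orientations. Norms: on $\Omega^1$, $\|f\|^2=\sum_{e\in X^1}f(e)^2/\deg e$; on $\Omega^0$, $\|f\|^2=\sum_vf(v)^2$; $\Omega^k_{L^2}$ denotes forms of finite norm. Upper Laplacian on $\Omega^1_{L^2}$: $(\Delta^+f)(e)=f(e)-\sum_{e'\sim e}f(e')/\deg e'$. $\delta_1:\Omega^0\to\Omega^1$, $(\delta_1f)([u,v])=\deg\{u,v\}\,(f(v)-f(u))$.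 $B^1=\{\delta_1f:f\in\Omega^0_{L^2}\}\cap\Omega^1_{L^2}$, $Z_1=(B^1)^\perp\subseteq\Omega^1_{L^2}$ (for finite $X$ this is $\ker\partial_1$, $(\partial_1f)(v)=\sum_{u:\{u,v\}\in X}f([u,v])$), and the spectral gap is $\lambda(X)=\min\operatorname{Spec}(\Delta^+|_{Z_1})$. $T^2_2$ is built by starting with one triangle and repeatedly attaching, to every edge currently contained in only one triangle, one new triangle formed by that edge and a new vertex; every edge of $T^2_2$ lies in exactly two triangles. The distance between edges $e,e'$ is the minimal $n$ with edges $e=\tau_0,\dots,\tau_n=e'$ such that $\tau_i\cup\tau_{i+1}$ is a triangle. The ball $B_r(X,e_0)$ is the subcomplex consisting of the edges at distance $\le r$ from $e_0$, the triangles all of whose edges are at distance $\le r$, and all subsets of these. $X_r\to T^2_2$ refers to convergence of marked complexes: balls of every fixed radius around $e_0$ eventually coincide. *)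

theory Defs
  imports "HOL-Analysis.Analysis"
begin

type_synonym 'a cplx = "'a set set"

definition verts :: "'a cplx \<Rightarrow> 'a set" where
  "verts X = {v. {v} \<in> X}"

definition cells :: "'a cplx \<Rightarrow> nat \<Rightarrow> 'a set set" where
  "cells X j = {s \<in> X. finite s \<and> card s = Suc j}"

definition deg :: "'a cplx \<Rightarrow> 'a set \<Rightarrow> nat" where
  "deg X s = card {t \<in> X. s \<subseteq> t \<and> finite t \<and> card t = Suc (card s)}"

definition oedges :: "'a cplx \<Rightarrow> ('a \<times> 'a) set" where
  "oedges X = {(u,v). u \<noteq> v \<and> {u,v} \<in> X}"

definition edeg :: "'a cplx \<Rightarrow> 'a \<times> 'a \<Rightarrow> real" where
  "edeg X e = real (deg X {fst e, snd e})"

definition orient :: "'a set \<Rightarrow> 'a \<times> 'a" where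
  "orient e = (SOME p. fst p \<noteq> snd p \<and> e = {fst p, snd p})"

text \<open>faces of the oriented triangle [a,b,c] with induced orientations
  (invariant under even permutations, i.e. cyclic shifts)\<close>
definition tri_faces :: "'a \<Rightarrow> 'a \<Rightarrow> 'a \<Rightarrow> ('a \<times> 'a) set" where
  "tri_faces a b c = {(b,c), (c,a), (a,b)}"

definition nbr :: "'a cplx \<Rightarrow> 'a \<times> 'a \<Rightarrow> 'a \<times> 'a \<Rightarrow> bool" where
  "nbr X e e' \<longleftrightarrow> (\<exists>a b c. {a,b,c} \<in> X \<and> card {a,b,c} = 3 \<and>
      e \<in> tri_faces a b c \<and> (snd e', fst e') \<in> tri_faces a b c \<and> e \<noteq> (snd e', fst e'))"

definition Omega1 :: "'a cplx \<Rightarrow> ('a \<times> 'a \<Rightarrow> real) set" where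
  "Omega1 X = {f. (\<forall>u v. f (v,u) = - f (u,v)) \<and> (\<forall>p. p \<notin> oedges X \<longrightarrow> f p = 0)}"

definition Omega1_L2 :: "'a cplx \<Rightarrow> ('a \<times> 'a \<Rightarrow> real) set" where
  "Omega1_L2 X = {f \<in> Omega1 X.
      (\<lambda>e. (f (orient e))\<^sup>2 / real (deg X e)) summable_on cells X 1}"

definition inner1 :: "'a cplx \<Rightarrow> ('a \<times> 'a \<Rightarrow> real) \<Rightarrow> ('a \<times> 'a \<Rightarrow> real) \<Rightarrow> real" where
  "inner1 X f g = (\<Sum>\<^sub>\<infinity>e\<in>cells X 1. f (orient e) * g (orient e) / real (deg X e))"

definition Omega0 :: "'a cplx \<Rightarrow> ('a \<Rightarrow> real) set" where
  "Omega0 X = {f. \<forall>v. v \<notin> verts X \<longrightarrow> f v = 0}"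

definition Omega0_L2 :: "'a cplx \<Rightarrow> ('a \<Rightarrow> real) set" where
  "Omega0_L2 X = {f \<in> Omega0 X. (\<lambda>v. (f v)\<^sup>2) summable_on verts X}"

definition delta1 :: "'a cplx \<Rightarrow> ('a \<Rightarrow> real) \<Rightarrow> 'a \<times> 'a \<Rightarrow> real" where
  "delta1 X f p = (if p \<in> oedges X then edeg X p * (f (snd p) - f (fst p)) else 0)"

definition B1 :: "'a cplx \<Rightarrow> ('a \<times> 'a \<Rightarrow> real) set" where
  "B1 X = (delta1 X ` Omega0_L2 X) \<inter> Omega1_L2 X"

definition Z1 :: "'a cplx \<Rightarrow> ('a \<times> 'a \<Rightarrow> real) set" where
  "Z1 X = {f \<in> Omega1_L2 X. \<forall>g \<in> B1 X. inner1 X f g = 0}"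

definition upper_lap :: "'a cplx \<Rightarrow> ('a \<times> 'a \<Rightarrow> real) \<Rightarrow> 'a \<times> 'a \<Rightarrow> real" where
  "upper_lap X f e = (if e \<in> oedges X
      then f e - (\<Sum>e'\<in>{e'. nbr X e e'}. f e' / edeg X e') else 0)"

text \<open>Spectrum of the (bounded, self-adjoint) operator upper_lap restricted to the Hilbert
  space Z1: mu is in the spectrum iff upper_lap - mu is not a bijection of Z1 onto itself
  (a bounded inverse is then automatic by the open mapping theorem).\<close>
definition spec_Z1 :: "'a cplx \<Rightarrow> real set" where
  "spec_Z1 X = {mu. \<not> bij_betw (\<lambda>f e. upper_lap X f e - mu * f e) (Z1 X) (Z1 X)}"

definition spectral_gap :: "'a cplx \<Rightarrow> real" where
  "spectral_gap X = Inf (spec_Z1 X)"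

definition eadj :: "'a cplx \<Rightarrow> 'a set \<Rightarrow> 'a set \<Rightarrow> bool" where
  "eadj X e e' \<longleftrightarrow> e \<in> cells X 1 \<and> e' \<in> cells X 1 \<and> e \<union> e' \<in> cells X 2"

definition ball_edges :: "'a cplx \<Rightarrow> 'a set \<Rightarrow> nat \<Rightarrow> 'a set set" where
  "ball_edges X e0 r = {e \<in> cells X 1. \<exists>n \<le> r. \<exists>p :: nat \<Rightarrow> 'a set.
      p 0 = e0 \<and> p n = e \<and> (\<forall>i<n. eadj X (p i) (p (Suc i)))}"

definition ball :: "'a cplx \<Rightarrow> 'a set \<Rightarrow> nat \<Rightarrow> 'a cplx" where
  "ball X e0 r =
     {s. \<exists>e \<in> ball_edges X e0 r. s \<subseteq> e} \<union>
     {s. \<exists>t \<in> cells X 2. (\<forall>e \<in> cells X 1. e \<subseteq> t \<longrightarrow> e \<in> ball_edges X e0 r) \<and> s \<subseteq> t}"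

text \<open>Vertices: R 0, R 1, R 2 of the initial triangle; N i bs is the new vertex of the triangle
  indexed by (i, bs): i < 3 says to which edge of the initial triangle the first new triangle is
  attached; bs (most recent choice first) records, at each later step, which of the two boundary
  edges of the previous triangle the next triangle is attached to.\<close>
datatype vert = R nat | N nat "bool list"

fun base :: "nat \<Rightarrow> bool list \<Rightarrow> vert \<times> vert" where
  "base i [] = (if i = 0 then (R 1, R 2) else if i = 1 then (R 0, R 2) else (R 0, R 1))"
| "base i (b # bs) = ((if b then snd (base i bs) else fst (base i bs)), N i bs)"

definition tri :: "nat \<Rightarrow> bool list \<Rightarrow> vert set" where
  "tri i bs = {fst (base i bs), snd (base i bs), N i bs}"

definition T22_triangles :: "vert set set" where
  "T22_triangles = insert {R 0, R 1, R 2} {tri i bs | i bs. i < 3}"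

definition T22 :: "vert cplx" where
  "T22 = {s. \<exists>t \<in> T22_triangles. s \<subseteq> t}"

end

theory Submission
  imports Defs "HOL-Library.Function_Algebras"
begin

text \<open>Write \<open>g = f / deg\<close> and let \<open>h = dg\<close> be the circulation of \<open>g\<close> around triangles. Then
  \<open>\<Delta>\<^sup>+ f = \<partial>h\<close>, so on \<open>Z\<^sub>1\<close> the spectrum of \<open>\<Delta>\<^sup>+\<close> is governed by the operator \<open>d deg\<^sup>-\<^sup>1 \<partial>\<close> on functions on triangles.
  After a choice of orientations this is half the Laplacian of the 3-regular tree dual to \<open>T22\<close>, with a
  Dirichlet-like condition at the boundary of a ball.

  For a ball, a closed 1-form is exact, so \<open>Z\<^sub>1\<close> contains no closed forms except 0, and the Hardy inequality on the tree gives
  \<open>\<lambda> \<ge> 3/2 - sqrt 2\<close>. Radial functions \<open>2\<^bsup>-k/2\<^esup> sin (k\<theta>)\<close> on the part of the ball below the central edge,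
  with \<open>\<theta> \<le> \<pi>/(r-1)\<close> adjusted to the boundary condition, are eigenfunctions for
  \<open>3/2 - sqrt 2 cos \<theta>\<close>, which gives the limit.

  In \<open>T22\<close> all vertices have infinite degree, so \<open>B\<^sup>1 = 0\<close> and \<open>Z\<^sub>1\<close> is the whole \<open>L\<^sup>2\<close> space. It contains closed
  forms: start with a nonzero value on an edge and halve it at each step outwards. Hence 0 is an eigenvalue.\<close>

section \<open>Coding the edges and triangles of the complex\<close>

text \<open>The constant is the bottom of the spectrum of \<open>(3 - A)/2\<close>, where A is the
  adjacency operator of the 3-regular tree, whose norm is \<open>2 * sqrt 2\<close>. The operator on
  triangles has this bottom for \<open>T22\<close> as well; the difference between ball and limit
  comes only from closed forms. In a ball they are gradients, which \<open>Z1\<close> excludes; in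
  \<open>T22\<close> their potentials are not square-summable, so nothing excludes them. A boundary
  edge of a ball has degree 1 instead of 2, which acts like a ghost triangle carrying minus the
  value of the last triangle. As the spectrum is defined by bijectivity, a lower bound for it also
  needs surjectivity: a dimension count for balls, a Neumann series for \<open>T22\<close>. The
  trial functions live on one side of the central edge and vanish on the first triangle there. That
  side always looks the same, so the argument is uniform in \<open>e0\<close>.\<close>

type_synonym code = "nat \<times> bool list"

text \<open>The code \<open>(i, bs)\<close> stands for the edge \<open>base i bs\<close>, and every edge has exactly one code.
  The triangle \<open>Some c\<close> is the one attached below the edge \<open>c\<close>; \<open>None\<close> is the initial triangle.
  So the edge \<open>c\<close> lies in exactly the triangles \<open>up c\<close> and \<open>Some c\<close>.\<close>
definition codes :: "code set" where
  "codes = {c. fst c < 3}"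

definition ed :: "code \<Rightarrow> vert \<times> vert" where
  "ed c = base (fst c) (snd c)"

definition edge :: "code \<Rightarrow> vert set" where
  "edge c = {fst (ed c), snd (ed c)}"

definition child :: "bool \<Rightarrow> code \<Rightarrow> code" where
  "child b c = (fst c, b # snd c)"

fun up :: "code \<Rightarrow> code option" where
  "up (i, []) = None"
| "up (i, b # bs) = Some (i, bs)"

text \<open>Orient \<open>Some c\<close> by first end of \<open>ed c\<close>, second end, new
  vertex, and \<open>None\<close> by \<open>R 0\<close>, \<open>R 1\<close>, \<open>R 2\<close>.
  Then \<open>c\<close> has incidence 1 in \<open>Some c\<close>, and \<open>sg c\<close> is its
  incidence in the other triangle \<open>up c\<close>.\<close>

fun sg :: "code \<Rightarrow> real" where
  "sg (i, []) = (if i = 1 then -1 else 1)"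
| "sg (i, b # bs) = (if b then 1 else -1)"

fun sides :: "code option \<Rightarrow> code set" where
  "sides None = {(0,[]), (1,[]), (2,[])}"
| "sides (Some c) = {c, child False c, child True c}"

fun face :: "code option \<Rightarrow> vert set" where
  "face None = {R 0, R 1, R 2}"
| "face (Some c) = insert (N (fst c) (snd c)) (edge c)"

definition tcodes :: "code option set" where
  "tcodes = insert None (Some ` codes)"

definition inc :: "code option \<Rightarrow> code \<Rightarrow> real" where
  "inc t c = (if t = Some c then 1 else sg c)"

text \<open>The stage at which a vertex is attached. The ends of \<open>ed c\<close> are older than
  the vertex attached to that edge, which shows that new vertices are really new.\<close>

fun vdepth :: "vert \<Rightarrow> nat" where
  "vdepth (R n) = 0"
| "vdepth (N i bs) = Suc (length bs)"

lemma vdepth_base: "vdepth (fst (base i bs)) \<le> length bs" "vdepth (snd (base i bs)) \<le> length bs"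
  by (induction bs) auto

lemma ed_child [simp]:
  "ed (child b c) = ((if b then snd (ed c) else fst (ed c)), N (fst c) (snd c))"
  by (simp add: ed_def child_def)

lemma ed_Nil [simp]:
  "ed (i, []) = (if i = 0 then (R 1, R 2) else if i = 1 then (R 0, R 2) else (R 0, R 1))"
  by (simp add: ed_def)

lemma vdepth_ed: "vdepth (fst (ed c)) \<le> length (snd c)" "vdepth (snd (ed c)) \<le> length (snd c)"
  by (simp_all add: ed_def vdepth_base)

lemma N_neq_ed [simp]: "N (fst c) (snd c) \<noteq> fst (ed c)" "N (fst c) (snd c) \<noteq> snd (ed c)"
  "fst (ed c) \<noteq> N (fst c) (snd c)" "snd (ed c) \<noteq> N (fst c) (snd c)"
  using vdepth_ed[of c] by (metis Suc_n_not_le_n vdepth.simps(2))+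

lemma N_neq_ed_Pair [simp]: "N i bs \<noteq> fst (ed (i,bs))" "N i bs \<noteq> snd (ed (i,bs))"
  "fst (ed (i,bs)) \<noteq> N i bs" "snd (ed (i,bs)) \<noteq> N i bs"
  using N_neq_ed[of "(i,bs)"] by simp_all

lemma code_cases: 
  obtains (Nil) i where "c = (i, [])" | (child) b c' where "c = child b c'"
proof (cases c)
  case (Pair i bs)
  then show ?thesis using that by (cases bs) (auto simp: child_def)
qed

lemma ed_neq [simp]: "fst (ed c) \<noteq> snd (ed c)" "snd (ed c) \<noteq> fst (ed c)"
  by (cases c rule: code_cases; auto)+

lemma child_in_codes [simp]: "child b c \<in> codes \<longleftrightarrow> c \<in> codes"
  by (simp add: child_def codes_def)

lemma child_eq_iff [simp]: "child b c = child b' c' \<longleftrightarrow> b = b' \<and> c = c'"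
  by (auto simp: child_def prod_eq_iff)

lemma child_neq [simp]: "child b c \<noteq> c" "c \<noteq> child b c" "child b c \<noteq> (i, [])" "(i,[]) \<noteq> child b c"
  by (auto simp: child_def prod_eq_iff)

lemma up_child [simp]: "up (child b c) = Some c"
  by (simp add: child_def)

lemma sg_child [simp]: "sg (child b c) = (if b then 1 else -1)"
  by (simp add: child_def)

lemma Nil_in_codes: "(i, []) \<in> codes \<longleftrightarrow> i = 0 \<or> i = 1 \<or> i = 2"
  by (auto simp: codes_def)

lemma edge_child: "edge (child b c) = {(if b then snd (ed c) else fst (ed c)), N (fst c) (snd c)}"
  by (simp add: edge_def)

text \<open>The younger end of a noninitial edge names the triangle that created the edge; the older
  end then tells the two new edges apart.\<close>

lemma edge_inj: 
  assumes "edge c = edge c'" "c \<in> codes" "c' \<in> codes" shows "c = c'"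
proof (cases c rule: code_cases)
  case (Nil i)
  show ?thesis
  proof (cases c' rule: code_cases)
    case (Nil j) then show ?thesis using assms \<open>c = (i, [])\<close>
      by (auto simp: Nil_in_codes edge_def doubleton_eq_iff)
  next
    case (child b d) then show ?thesis using assms \<open>c = (i, [])\<close>
      by (auto simp: Nil_in_codes edge_def doubleton_eq_iff)
  qed
next
  case (child b d)
  note cd = this
  show ?thesis
  proof (cases c' rule: code_cases)
    case (Nil j) then show ?thesis using assms cd
      by (auto simp: Nil_in_codes edge_def doubleton_eq_iff)
  next
    case (child b' d')
    have e: "{(if b then snd (ed d) else fst (ed d)), N (fst d) (snd d)} =
       {(if b' then snd (ed d') else fst (ed d')), N (fst d') (snd d')}"
      using assms(1) cd child by (simp add: edge_child)
    \<comment> \<open>Otherwise each new vertex is the older end of the other edge, so each is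
      strictly older than the other.\<close>
    have "N (fst d) (snd d) = N (fst d') (snd d')"
    proof (rule ccontr)
      assume n: "N (fst d) (snd d) \<noteq> N (fst d') (snd d')"
      then have 1: "N (fst d) (snd d) = (if b' then snd (ed d') else fst (ed d'))"
        and 2: "N (fst d') (snd d') = (if b then snd (ed d) else fst (ed d))"
        using e by (auto simp: doubleton_eq_iff)
      have "Suc (length (snd d)) \<le> length (snd d')"
        using 1 vdepth_ed[of d'] by (metis vdepth.simps(2))
      moreover have "Suc (length (snd d')) \<le> length (snd d)"
        using 2 vdepth_ed[of d] by (metis vdepth.simps(2))
      ultimately show False by simp
    qed
    then have d: "d = d'" by (simp add: prod_eq_iff)
    then have "b = b'" using e by (auto simp: doubleton_eq_iff split: if_splits)
    with d show ?thesis using cd child by simp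
  qed
qed

lemma finite_edge [simp]: "finite (edge c)" by (simp add: edge_def)
lemma card_edge [simp]: "card (edge c) = 2" by (simp add: edge_def)
lemma finite_face [simp]: "finite (face t)" by (cases t) auto
lemma card_face [simp]: "card (face t) = 3" 
  by (cases t) (auto simp: edge_def card_insert_if)

lemma finite_sides [simp]: "finite (sides t)" by (cases t) auto

lemma None_in_tcodes [simp]: "None \<in> tcodes" by (simp add: tcodes_def)
lemma Some_in_tcodes [simp]: "Some c \<in> tcodes \<longleftrightarrow> c \<in> codes" by (auto simp: tcodes_def)

lemma sides_codes: "t \<in> tcodes \<Longrightarrow> c \<in> sides t \<Longrightarrow> c \<in> codes"
  by (cases t) (auto simp: Nil_in_codes)

lemma in_sides_iff: "c \<in> codes \<Longrightarrow> c \<in> sides t \<longleftrightarrow> t = up c \<or> t = Some c"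
  by (cases c rule: code_cases; cases t) (simp_all, auto simp: Nil_in_codes)

lemma up_in_tcodes: "c \<in> codes \<Longrightarrow> up c \<in> tcodes"
  by (cases c rule: code_cases) auto

lemma up_neq_Some [simp]: "up c \<noteq> Some c" "Some c \<noteq> up c"
  by (cases c rule: code_cases; auto)+

lemma edge_subset_face: "c \<in> sides t \<Longrightarrow> edge c \<subseteq> face t"
  by (cases t) (auto simp: edge_def)

lemma pair_in_face:
  assumes "s \<subseteq> face t" "card s = 2" "t \<in> tcodes"
  obtains c where "c \<in> sides t" "s = edge c"
proof -
  obtain a b where s: "s = {a,b}" "a \<noteq> b" using assms(2) by (meson card_2_iff)
  show thesis
  proof (cases t)
    case None
    have "s = {R 1, R 2} \<or> s = {R 0, R 2} \<or> s = {R 0, R 1}"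
      using assms(1) s None by auto
    moreover have "edge (0,[]) = {R 1,R 2}" "edge (1,[]) = {R 0, R 2}" "edge (2,[]) = {R 0, R 1}"
      by (auto simp: edge_def)
    ultimately show thesis using that None by (metis insertCI sides.simps(1))
  next
    case (Some c)
    have "s = edge c \<or> s = edge (child False c) \<or> s = edge (child True c)"
      using assms(1) s Some by (auto simp: edge_def)
    then show thesis using that Some by (metis insertCI sides.simps(2))
  qed
qed

lemma edge_subset_face_iff: 
  assumes "c \<in> codes" "t \<in> tcodes" shows "edge c \<subseteq> face t \<longleftrightarrow> c \<in> sides t"
  by (metis assms card_edge edge_inj edge_subset_face pair_in_face sides_codes)

text \<open>Equal faces have equal sides, and two common sides already pin down the triangle, since
  an edge \<open>c\<close> lies only in \<open>up c\<close> and \<open>Some c\<close>.\<close>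

lemma face_inj: 
  assumes "face t = face t'" "t \<in> tcodes" "t' \<in> tcodes" shows "t = t'"
proof -
  have s: "sides t = sides t'" 
    using assms edge_subset_face_iff sides_codes by blast
  show ?thesis
  proof (cases t)
    case None
    then have "(0,[]) \<in> sides t'" "(1,[]) \<in> sides t'" unfolding s[symmetric] by simp_all
    then have "t' = None \<or> t' = Some (0,[])" "t' = None \<or> t' = Some (1,[])"
      by (simp_all add: in_sides_iff Nil_in_codes)
    then show ?thesis using None by auto
  next
    case (Some c)
    then have "c \<in> sides t'" "child False c \<in> sides t'" "c \<in> codes"
      unfolding s[symmetric] using assms(2) by simp_all
    then have "t' = up c \<or> t' = Some c" "t' = Some c \<or> t' = Some (child False c)"
      using in_sides_iff[of c t'] in_sides_iff[of "child False c" t'] by auto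
    then show ?thesis using Some up_neq_Some[of c] by (cases "t' = Some c") (auto simp: child_def elim: up.elims)
  qed
qed

lemma T22_triangles_eq: "T22_triangles = face ` tcodes"
proof -
  have "tri i bs = face (Some (i,bs))" for i bs
    by (auto simp: tri_def edge_def ed_def)
  then show ?thesis unfolding T22_triangles_def tcodes_def codes_def
    by (force simp del: face.simps(2))
qed

lemma T22_iff: "s \<in> T22 \<longleftrightarrow> (\<exists>t\<in>tcodes. s \<subseteq> face t)"
  by (simp add: T22_def T22_triangles_eq)

lemma T22_triple: 
  assumes "s \<in> T22" "card s = 3" obtains t where "t \<in> tcodes" "s = face t"
  using assms unfolding T22_iff by (metis card_face card_subset_eq finite_face)

lemma T22_pair:
  assumes "s \<in> T22" "card s = 2" obtains c where "c \<in> codes" "s = edge c"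
  using assms unfolding T22_iff by (metis pair_in_face sides_codes)

lemma edge_in_T22: "c \<in> codes \<Longrightarrow> edge c \<in> T22"
  unfolding T22_iff by (metis edge_subset_face in_sides_iff up_in_tcodes)

lemma face_in_T22: "t \<in> tcodes \<Longrightarrow> face t \<in> T22"
  unfolding T22_iff by auto

text \<open>The vertex of \<open>t\<close> opposite to its side \<open>c\<close>; meaningless unless \<open>c\<close> is a side of \<open>t\<close>.\<close>
definition opp :: "code option \<Rightarrow> code \<Rightarrow> vert" where
  "opp t c = (if t = Some c then N (fst c) (snd c) else
     (case snd c of [] \<Rightarrow> R (fst c)
      | b # bs \<Rightarrow> (if b then fst (base (fst c) bs) else snd (base (fst c) bs))))"

lemma opp_simps [simp]:
  "opp (Some c) c = N (fst c) (snd c)"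
  "opp None (i,[]) = R i"
  "opp (Some c) (child b c) = (if b then fst (ed c) else snd (ed c))"
  by (auto simp: opp_def child_def ed_def prod_eq_iff)

lemma face_opp: "c \<in> sides t \<Longrightarrow> t \<in> tcodes \<Longrightarrow> face t = insert (opp t c) (edge c) \<and> opp t c \<notin> edge c"
  by (cases t) (auto simp: edge_def)

text \<open>The simplicial coboundary of a 1-cochain, evaluated on the oriented triangle
  \<open>t\<close>.\<close>

definition curl :: "(code \<Rightarrow> real) \<Rightarrow> code option \<Rightarrow> real" where
  "curl G t = (\<Sum>c\<in>sides t. inc t c * G c)"

lemma curl_simps: 
  "curl G None = G (0,[]) - G (1,[]) + G (2,[])"
  "curl G (Some c) = G c + G (child True c) - G (child False c)"
  by (auto simp: curl_def inc_def)

text \<open>The left side runs around \<open>t\<close> in the direction given by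
  \<open>ed c\<close>, which is the chosen orientation of \<open>t\<close> up to the sign
  \<open>inc t c\<close>.\<close>

lemma inc_curl:
  assumes "c \<in> sides t" "t \<in> tcodes" "\<And>u v. g (v,u) = - g (u,v)"
  shows "g (ed c) + g (snd (ed c), opp t c) + g (opp t c, fst (ed c))
    = inc t c * curl (\<lambda>c. g (ed c)) t"
proof (cases t)
  case None
  have "g (R 1, R 0) = - g (R 0, R 1)" "g (R 2, R 0) = - g (R 0, R 2)" "g (R 2, R 1) = - g (R 1, R 2)"
    by (rule assms(3))+
  then show ?thesis using assms(1,2) None by (auto simp: curl_simps inc_def)
next
  case (Some c')
  obtain x y where xy: "ed c' = (x,y)" by (cases "ed c'")
  let ?n = "N (fst c') (snd c')"
  have "g (y,x) = - g (x,y)" "g (?n,x) = - g (x,?n)" "g (?n,y) = - g (y,?n)"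
    by (rule assms(3))+
  then show ?thesis using assms(1,2) Some xy by (auto simp: curl_simps inc_def)
qed

section \<open>Forms and the upper Laplacian in the coding\<close>

definition link2 :: "'a cplx \<Rightarrow> 'a \<Rightarrow> 'a \<Rightarrow> 'a set" where
  "link2 X a b = {z. {a,b,z} \<in> X \<and> card {a,b,z} = 3}"

lemma link2_commute: "link2 X a b = link2 X b a"
  by (simp add: link2_def insert_commute)

lemma card_3_distinct: "card {a,b,c} = 3 \<longleftrightarrow> a \<noteq> b \<and> b \<noteq> c \<and> a \<noteq> c"
  by (auto simp: card_insert_if)

text \<open>Besides \<open>(a,b)\<close>, the oriented triangle on \<open>a\<close>,
  \<open>b\<close>, \<open>z\<close> has the faces \<open>(b,z)\<close> and \<open>(z,a)\<close>;
  their reversals are the two neighbours contributed by \<open>z\<close>.\<close>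

lemma nbr_eq_link2: "{e'. nbr X (a,b) e'} = (\<lambda>z. (z,b)) ` link2 X a b \<union> (\<lambda>z. (a,z)) ` link2 X a b"
  (is "?L = ?R")
proof (intro set_eqI iffI)
  fix e' assume "e' \<in> ?L"
  then obtain x y z where h: "{x,y,z} \<in> X" "card {x,y,z} = 3" "(a,b) \<in> {(y,z),(z,x),(x,y)}"
    "(snd e', fst e') \<in> {(y,z),(z,x),(x,y)}" "(a,b) \<noteq> (snd e', fst e')"
    unfolding nbr_def tri_faces_def by blast
  have perm: "{y,z,x} = {x,y,z}" "{z,x,y} = {x,y,z}" by auto
  have 1: "z \<in> link2 X x y" "x \<in> link2 X y z" "y \<in> link2 X z x"
    using h(1,2) by (simp_all add: link2_def perm)
  show "e' \<in> ?R"
    using h(3-5) 1 by (cases e') auto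
next
  fix e' assume "e' \<in> ?R"
  then obtain z where z: "{a,b,z} \<in> X" "card {a,b,z} = 3" "e' = (z,b) \<or> e' = (a,z)"
    by (auto simp: link2_def)
  then show "e' \<in> ?L"
    unfolding nbr_def tri_faces_def mem_Collect_eq
    by (intro exI[of _ a] exI[of _ b] exI[of _ z]) (auto simp: card_3_distinct)
qed

lemma upper_lap_link2:
  assumes "(a,b) \<in> oedges X" "finite (link2 X a b)"
  shows "upper_lap X f (a,b) = f (a,b) - 
    (\<Sum>z\<in>link2 X a b. f (z,b) / edeg X (z,b) + f (a,z) / edeg X (a,z))"
proof -
  have "(\<lambda>z. (z,b)) ` link2 X a b \<inter> (\<lambda>z. (a,z)) ` link2 X a b = {}"
    by (auto simp: link2_def card_3_distinct)
  moreover have "inj_on (\<lambda>z. (z,b)) (link2 X a b)" "inj_on (\<lambda>z. (a,z)) (link2 X a b)"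
    by (auto simp: inj_on_def)
  ultimately show ?thesis
    using assms by (simp add: upper_lap_def nbr_eq_link2 sum.union_disjoint sum.reindex sum.distrib)
qed

lemma edeg_commute: "edeg X (u,v) = edeg X (v,u)"
  by (simp add: edeg_def insert_commute)

lemma oedges_commute: "(u,v) \<in> oedges X \<longleftrightarrow> (v,u) \<in> oedges X"
  by (auto simp: oedges_def insert_commute)

lemma deg_eq_card_link2:
  assumes "a \<noteq> b" shows "deg X {a,b} = card (link2 X a b)"
proof -
  have "{t \<in> X. {a,b} \<subseteq> t \<and> finite t \<and> card t = Suc (card {a,b})} = (\<lambda>z. {a,b,z}) ` link2 X a b"
    (is "?L = ?R")
  proof (intro set_eqI iffI)
    fix t assume t: "t \<in> ?L"
    then have "card (t - {a,b}) = 1" using assms by (simp add: card_Diff_subset)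
    then obtain z where "t - {a,b} = {z}" by (auto simp: card_1_singleton_iff)
    then have "t = {a,b,z}" using t by auto
    then show "t \<in> ?R" using t assms by (auto simp: link2_def)
  next
    fix t assume "t \<in> ?R" then show "t \<in> ?L" using assms by (auto simp: link2_def)
  qed
  moreover have "inj_on (\<lambda>z. {a,b,z}) (link2 X a b)"
    by (rule inj_onI) (auto simp: link2_def card_3_distinct)
  ultimately show ?thesis by (simp add: deg_def card_image)
qed

lemma Omega1_flip: "f \<in> Omega1 X \<Longrightarrow> f (v,u) = - f (u,v)"
  unfolding Omega1_def by blast

lemma Omega1_outside: "f \<in> Omega1 X \<Longrightarrow> p \<notin> oedges X \<Longrightarrow> f p = 0"
  unfolding Omega1_def by blast

lemma Omega1I: "(\<And>u v. f (v,u) = - f (u,v)) \<Longrightarrow> (\<And>p. p \<notin> oedges X \<Longrightarrow> f p = 0) \<Longrightarrow> f \<in> Omega1 X"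
  unfolding Omega1_def by blast

lemma upper_lap_Omega1:
  assumes "f \<in> Omega1 X" "\<And>a b. finite (link2 X a b)"
  shows "upper_lap X f \<in> Omega1 X"
proof -
  have as: "f (v,u) = - f (u,v)" for u v by (rule Omega1_flip[OF assms(1)])
  have "upper_lap X f (v,u) = - upper_lap X f (u,v)" for u v
  proof (cases "(u,v) \<in> oedges X")
    case True
    have "(\<Sum>z\<in>link2 X v u. f (z,u) / edeg X (z,u) + f (v,z) / edeg X (v,z)) =
       - (\<Sum>z\<in>link2 X u v. f (z,v) / edeg X (z,v) + f (u,z) / edeg X (u,z))"
      unfolding link2_commute[of X v u] sum_negf[symmetric]
    proof (rule sum.cong)
      fix z
      show "f (z,u) / edeg X (z,u) + f (v,z) / edeg X (v,z) =
        - (f (z,v) / edeg X (z,v) + f (u,z) / edeg X (u,z))"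
        using as[of z u] as[of v z] edeg_commute[of X z u] edeg_commute[of X v z] by simp
    qed simp
    with True oedges_commute[of u v X] as[of v u] show ?thesis
      by (simp add: upper_lap_link2 assms(2))
  next
    case False
    then show ?thesis using oedges_commute[of u v X] by (simp add: upper_lap_def)
  qed
  then show ?thesis by (rule Omega1I) (simp add: upper_lap_def)
qed

text \<open>Since \<open>f (a,b)\<close> is the degree times \<open>g (a,b)\<close>, one copy of
  \<open>g (a,b)\<close> can be given to each triangle at the edge, completing its two neighbour
  terms to a circulation. The nonempty link makes the degree nonzero, so that dividing by it loses
  nothing.\<close>

lemma upper_lap_triangles:
  assumes "f \<in> Omega1 X" "\<And>a b. finite (link2 X a b)" "(a,b) \<in> oedges X" "link2 X a b \<noteq> {}"
  defines "g \<equiv> \<lambda>p. f p / edeg X p"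
  shows "upper_lap X f (a,b) = (\<Sum>z\<in>link2 X a b. g (a,b) + g (b,z) + g (z,a))"
proof -
  have as: "f (v,u) = - f (u,v)" for u v by (rule Omega1_flip[OF assms(1)])
  have ag: "g (v,u) = - g (u,v)" for u v
    unfolding g_def using as[of v u] edeg_commute[of X v u] by simp
  have ab: "a \<noteq> b" using assms(3) by (simp add: oedges_def)
  have d: "edeg X (a,b) = real (card (link2 X a b))" using deg_eq_card_link2[OF ab] by (simp add: edeg_def)
  then have "edeg X (a,b) \<noteq> 0" using assms(2,4) by simp
  then have "f (a,b) = (\<Sum>z\<in>link2 X a b. g (a,b))" using d by (simp add: g_def)
  then have "upper_lap X f (a,b) = (\<Sum>z\<in>link2 X a b. g (a,b)) - (\<Sum>z\<in>link2 X a b. g (z,b) + g (a,z))"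
    using upper_lap_link2[OF assms(3) assms(2)] by (simp add: g_def)
  also have "\<dots> = (\<Sum>z\<in>link2 X a b. g (a,b) - (g (z,b) + g (a,z)))" by (simp add: sum_subtractf)
  also have "\<dots> = (\<Sum>z\<in>link2 X a b. g (a,b) + g (b,z) + g (z,a))"
  proof (rule sum.cong)
    fix z show "g (a,b) - (g (z,b) + g (a,z)) = g (a,b) + g (b,z) + g (z,a)"
      using ag[of b z] ag[of z a] by simp
  qed simp
  finally show ?thesis .
qed

section \<open>Cochains indexed by codes\<close>

definition ecodes :: "vert cplx \<Rightarrow> code set" where
  "ecodes X = {c \<in> codes. edge c \<in> X}"

definition fcodes :: "vert cplx \<Rightarrow> code option set" where
  "fcodes X = {t \<in> tcodes. face t \<in> X}"

definition cofaces :: "vert cplx \<Rightarrow> code \<Rightarrow> code option set" where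
  "cofaces X c = {t \<in> fcodes X. c \<in> sides t}"

definition cdeg :: "vert cplx \<Rightarrow> code \<Rightarrow> real" where
  "cdeg X c = real (card (cofaces X c))"

definition bdry :: "vert cplx \<Rightarrow> (code option \<Rightarrow> real) \<Rightarrow> code \<Rightarrow> real" where
  "bdry X h c = (\<Sum>t\<in>cofaces X c. inc t c * h t)"

lemma cofaces_subset: "c \<in> codes \<Longrightarrow> cofaces X c \<subseteq> {up c, Some c}"
  by (auto simp: cofaces_def in_sides_iff)

lemma cofaces_eq: "c \<in> codes \<Longrightarrow> cofaces X c = {t \<in> {up c, Some c}. t \<in> fcodes X}"
  by (auto simp: cofaces_def in_sides_iff)

lemma finite_cofaces: "c \<in> codes \<Longrightarrow> finite (cofaces X c)"
  using cofaces_subset finite_subset by blast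

lemma orient_edge: "orient (edge c) = ed c \<or> orient (edge c) = (snd (ed c), fst (ed c))"
proof -
  have "\<exists>p. fst p \<noteq> snd p \<and> edge c = {fst p, snd p}"
    by (rule exI[of _ "ed c"]) (simp add: edge_def)
  then have "fst (orient (edge c)) \<noteq> snd (orient (edge c)) \<and> edge c = {fst (orient (edge c)), snd (orient (edge c))}"
    unfolding orient_def by (rule someI_ex)
  then show ?thesis by (auto simp: edge_def doubleton_eq_iff prod_eq_iff)
qed

lemma Omega1_antisym: "f \<in> Omega1 X \<Longrightarrow> f (snd p, fst p) = - f p"
  using Omega1_flip[of f X "snd p" "fst p"] by simp

text \<open>A product of two antisymmetric forms ignores orientation, so the arbitrary choice in
  \<open>orient\<close> disappears from norms and inner products.\<close>

lemma orient_edge_mult: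
  assumes "f \<in> Omega1 X" "g \<in> Omega1 X"
  shows "f (orient (edge c)) * g (orient (edge c)) = f (ed c) * g (ed c)"
  using orient_edge[of c] Omega1_antisym[OF assms(1), of "ed c"] Omega1_antisym[OF assms(2), of "ed c"] 
  by auto

lemma link2_ed:
  assumes "X \<subseteq> T22" "c \<in> codes"
  shows "link2 X (fst (ed c)) (snd (ed c)) = (\<lambda>t. opp t c) ` cofaces X c"
proof (intro set_eqI iffI)
  fix z assume "z \<in> link2 X (fst (ed c)) (snd (ed c))"
  then have z: "insert z (edge c) \<in> X" "card (insert z (edge c)) = 3"
    by (simp_all add: link2_def edge_def insert_commute)
  then obtain t where t: "t \<in> tcodes" "insert z (edge c) = face t" using assms by (meson T22_triple subsetD)
  then have "c \<in> sides t" using edge_subset_face_iff assms by blast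
  moreover from this have "z = opp t c" using t face_opp[of c t] z(2)
    by (metis card_edge card_insert_if finite_edge insertE insert_iff numeral_eq_iff semiring_norm(89))
  ultimately show "z \<in> (\<lambda>t. opp t c) ` cofaces X c" using t z by (auto simp: cofaces_def fcodes_def)
next
  fix z assume "z \<in> (\<lambda>t. opp t c) ` cofaces X c"
  then obtain t where t: "t \<in> tcodes" "face t \<in> X" "c \<in> sides t" "z = opp t c"
    by (auto simp: cofaces_def fcodes_def)
  then have "face t = {fst (ed c), snd (ed c), z}" using face_opp[of c t] by (auto simp: edge_def)
  then show "z \<in> link2 X (fst (ed c)) (snd (ed c))" using t card_face[of t] by (simp add: link2_def)
qed

lemma inj_on_opp: "c \<in> codes \<Longrightarrow> inj_on (\<lambda>t. opp t c) (cofaces X c)"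
proof (rule inj_onI)
  fix t t' assume h: "t \<in> cofaces X c" "t' \<in> cofaces X c" "opp t c = opp t' c"
  then have "face t = face t'" using face_opp[of c t] face_opp[of c t'] by (auto simp: cofaces_def fcodes_def)
  then show "t = t'" using h face_inj by (auto simp: cofaces_def fcodes_def)
qed

lemma edeg_ed: 
  assumes "X \<subseteq> T22" "c \<in> codes" shows "edeg X (ed c) = cdeg X c"
proof -
  have "deg X (edge c) = card (link2 X (fst (ed c)) (snd (ed c)))"
    unfolding edge_def by (rule deg_eq_card_link2) simp
  then show ?thesis using assms
    by (simp add: edeg_def cdeg_def edge_def link2_ed card_image inj_on_opp)
qed

lemma deg_edge: 
  assumes "X \<subseteq> T22" "c \<in> codes" shows "real (deg X (edge c)) = cdeg X c"
  using edeg_ed[OF assms] by (simp add: edeg_def edge_def)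

text \<open>By \<open>pure\<close> every edge lies in a triangle, so all degrees are positive. The
  ball of radius 0, a single edge, is thereby excluded.\<close>

locale subcomplex =
  fixes X :: "vert cplx"
  assumes sub: "X \<subseteq> T22"
    and down: "s \<in> X \<Longrightarrow> s' \<subseteq> s \<Longrightarrow> s' \<in> X"
    and pure: "c \<in> ecodes X \<Longrightarrow> cofaces X c \<noteq> {}"
begin

lemma cells_1: "cells X 1 = edge ` ecodes X"
proof (intro set_eqI iffI)
  fix e assume "e \<in> cells X 1"
  then have "e \<in> X" "card e = 2" by (auto simp: cells_def)
  then obtain c where "c \<in> codes" "e = edge c" using sub T22_pair by blast
  then show "e \<in> edge ` ecodes X" using \<open>e \<in> X\<close> by (simp add: ecodes_def)
qed (auto simp: cells_def ecodes_def)

lemma ecodes_codes: "c \<in> ecodes X \<Longrightarrow> c \<in> codes" by (simp add: ecodes_def)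

lemma inj_edge: "inj_on edge (ecodes X)"
  unfolding inj_on_def ecodes_def using edge_inj by blast

lemma oedges_pair: 
  assumes "(u,v) \<in> oedges X" obtains c where "c \<in> ecodes X" "(u,v) = ed c \<or> (v,u) = ed c"
proof -
  have "u \<noteq> v" "{u,v} \<in> X" using assms by (auto simp: oedges_def)
  then have "{u,v} \<in> cells X 1" by (simp add: cells_def)
  then obtain c where c: "c \<in> ecodes X" "{u,v} = edge c" using cells_1 by auto
  then have "(u,v) = ed c \<or> (v,u) = ed c" by (auto simp: edge_def doubleton_eq_iff prod_eq_iff)
  with c that show thesis by blast
qed

lemma ed_oedges: "c \<in> ecodes X \<Longrightarrow> ed c \<in> oedges X"
  using ed_neq(1)[of c] by (simp add: oedges_def ecodes_def edge_def case_prod_beta)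

lemma cdeg_pos: "c \<in> ecodes X \<Longrightarrow> cdeg X c > 0"
  using pure finite_cofaces ecodes_codes by (simp add: cdeg_def card_gt_0_iff)

lemma finite_link2: "finite (link2 X a b)"
proof (cases "link2 X a b = {}")
  case False
  then obtain z where z: "{a,b,z} \<in> X" "card {a,b,z} = 3" by (auto simp: link2_def)
  then have "(a,b) \<in> oedges X" using down[of "{a,b,z}" "{a,b}"] by (auto simp: oedges_def card_3_distinct)
  then obtain c where c: "c \<in> ecodes X" "(a,b) = ed c \<or> (b,a) = ed c" using oedges_pair by blast
  then have "link2 X a b = link2 X (fst (ed c)) (snd (ed c))"
    using link2_commute[of X a b] by (metis fst_conv snd_conv)
  then show ?thesis using c finite_cofaces ecodes_codes link2_ed[OF sub] by simp
qed simp

lemma sides_ecodes: "t \<in> fcodes X \<Longrightarrow> c \<in> sides t \<Longrightarrow> c \<in> ecodes X"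
  using down edge_subset_face sides_codes unfolding fcodes_def ecodes_def by blast

lemma upper_lap_in: "f \<in> Omega1 X \<Longrightarrow> upper_lap X f \<in> Omega1 X"
  by (rule upper_lap_Omega1) (simp_all add: finite_link2)

text \<open>\<open>inc_curl\<close> turns each circulation in \<open>upper_lap_triangles\<close> to
  the fixed orientation of its triangle. This factorisation through functions on triangles carries
  both the finite and the infinite case.\<close>

lemma upper_lap_ed:
  assumes f: "f \<in> Omega1 X" and c: "c \<in> ecodes X"
  shows "upper_lap X f (ed c) = bdry X (curl (\<lambda>c. f (ed c) / cdeg X c)) c"
proof -
  let ?g = "\<lambda>p. f p / edeg X p"
  have ag: "?g (v,u) = - ?g (u,v)" for u v
    using Omega1_flip[OF f, of v u] edeg_commute[of X v u] by simp
  have cc: "c \<in> codes" using c ecodes_codes by simp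
  have ne: "link2 X (fst (ed c)) (snd (ed c)) \<noteq> {}"
    using pure[OF c] by (simp add: link2_ed[OF sub cc])
  have "upper_lap X f (ed c) = (\<Sum>z\<in>link2 X (fst (ed c)) (snd (ed c)). ?g (ed c) + ?g (snd (ed c),z) + ?g (z,fst (ed c)))"
    using upper_lap_triangles[OF f finite_link2 _ ne] ed_oedges[OF c] by simp
  also have "\<dots> = (\<Sum>t\<in>cofaces X c. ?g (ed c) + ?g (snd (ed c),opp t c) + ?g (opp t c,fst (ed c)))"
    unfolding link2_ed[OF sub cc] by (subst sum.reindex[OF inj_on_opp[OF cc]]) simp
  also have "\<dots> = (\<Sum>t\<in>cofaces X c. inc t c * curl (\<lambda>c. ?g (ed c)) t)"
  proof (rule sum.cong)
    fix t assume "t \<in> cofaces X c"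
    then have "c \<in> sides t" "t \<in> tcodes" by (simp_all add: cofaces_def fcodes_def)
    then show "?g (ed c) + ?g (snd (ed c),opp t c) + ?g (opp t c,fst (ed c)) = inc t c * curl (\<lambda>c. ?g (ed c)) t"
      using ag by (rule inc_curl[where g = ?g])
  qed simp
  also have "\<dots> = (\<Sum>t\<in>cofaces X c. inc t c * curl (\<lambda>c. f (ed c) / cdeg X c) t)"
  proof (rule sum.cong)
    fix t assume t: "t \<in> cofaces X c"
    have "curl (\<lambda>c. ?g (ed c)) t = curl (\<lambda>c. f (ed c) / cdeg X c) t"
      unfolding curl_def
    proof (rule sum.cong)
      fix c' assume "c' \<in> sides t"
      then have "c' \<in> codes" using t sides_codes unfolding cofaces_def fcodes_def by blast
      then show "inc t c' * ?g (ed c') = inc t c' * (f (ed c') / cdeg X c')"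
        by (simp add: edeg_ed[OF sub])
    qed simp
    then show "inc t c * curl (\<lambda>c. ?g (ed c)) t = inc t c * curl (\<lambda>c. f (ed c) / cdeg X c) t" by simp
  qed simp
  finally show ?thesis by (simp add: bdry_def)
qed

lemma inner1_codes:
  assumes "f \<in> Omega1 X" "g \<in> Omega1 X"
  shows "inner1 X f g = (\<Sum>\<^sub>\<infinity>c\<in>ecodes X. f (ed c) * g (ed c) / cdeg X c)"
proof -
  have "inner1 X f g = (\<Sum>\<^sub>\<infinity>c\<in>ecodes X. f (orient (edge c)) * g (orient (edge c)) / real (deg X (edge c)))"
    unfolding inner1_def cells_1 by (subst infsum_reindex[OF inj_edge]) (simp add: o_def)
  also have "\<dots> = (\<Sum>\<^sub>\<infinity>c\<in>ecodes X. f (ed c) * g (ed c) / cdeg X c)"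
    by (rule infsum_cong) (simp add: orient_edge_mult[OF assms] deg_edge[OF sub] ecodes_codes)
  finally show ?thesis .
qed

lemma L2_codes:
  "f \<in> Omega1_L2 X \<longleftrightarrow> f \<in> Omega1 X \<and> (\<lambda>c. (f (ed c))\<^sup>2 / cdeg X c) summable_on ecodes X"
proof -
  have "(\<lambda>e. (f (orient e))\<^sup>2 / real (deg X e)) summable_on cells X 1 \<longleftrightarrow>
    (\<lambda>c. (f (ed c))\<^sup>2 / cdeg X c) summable_on ecodes X" if "f \<in> Omega1 X"
    unfolding cells_1 summable_on_reindex[OF inj_edge] o_def
    by (rule summable_on_cong) (simp add: power2_eq_square orient_edge_mult[OF that that] deg_edge[OF sub] ecodes_codes)
  then show ?thesis by (auto simp: Omega1_L2_def)
qed

lemma Omega1_eqI: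
  assumes "f \<in> Omega1 X" "g \<in> Omega1 X" "\<And>c. c \<in> ecodes X \<Longrightarrow> f (ed c) = g (ed c)"
  shows "f = g"
proof
  fix p :: "vert \<times> vert"
  show "f p = g p"
  proof (cases "p \<in> oedges X")
    case True
    obtain u v where p: "p = (u,v)" by (cases p)
    with True obtain c where c: "c \<in> ecodes X" "(u,v) = ed c \<or> (v,u) = ed c" using oedges_pair by blast
    have "f (u,v) = - f (v,u)" "g (u,v) = - g (v,u)" using assms(1,2) by (blast intro: Omega1_flip)+
    then show ?thesis using c assms(3)[OF c(1)] p by metis
  next
    case False
    then show ?thesis using assms Omega1_outside by metis
  qed
qed

text \<open>Inverse to reading a form along \<open>ed\<close>: extends a cochain on codes
  antisymmetrically. By \<open>ed_swap\<close> no edge is coded in both orientations.\<close>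

definition form :: "(code \<Rightarrow> real) \<Rightarrow> vert \<times> vert \<Rightarrow> real" where
  "form F p = (if \<exists>c\<in>ecodes X. p = ed c then F (THE c. c \<in> ecodes X \<and> p = ed c)
     else if \<exists>c\<in>ecodes X. prod.swap p = ed c then - F (THE c. c \<in> ecodes X \<and> prod.swap p = ed c) else 0)"

lemma ed_inj: "c \<in> codes \<Longrightarrow> c' \<in> codes \<Longrightarrow> ed c = ed c' \<Longrightarrow> c = c'"
  by (rule edge_inj) (auto simp: edge_def)

lemma form_ed: assumes "c \<in> ecodes X" shows "form F (ed c) = F c"
proof -
  have "(THE c'. c' \<in> ecodes X \<and> ed c = ed c') = c"
    using assms ed_inj ecodes_codes by (intro the_equality) auto
  then show ?thesis using assms by (auto simp: form_def)
qed

lemma ed_swap: "c \<in> codes \<Longrightarrow> c' \<in> codes \<Longrightarrow> prod.swap (ed c) \<noteq> ed c'"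
proof
  assume h: "c \<in> codes" "c' \<in> codes" "prod.swap (ed c) = ed c'"
  then have "edge c = edge c'" by (auto simp: edge_def prod_eq_iff insert_commute)
  then have "c = c'" using edge_inj h by blast
  then have "prod.swap (ed c) = ed c" using h(3) by simp
  then show False using ed_neq[of c] by (metis fst_swap)
qed

lemma form_Omega1: "form F \<in> Omega1 X"
proof -
  have 1: "form F (prod.swap p) = - form F p" for p
    using ed_swap ecodes_codes unfolding form_def swap_swap
    by (smt (verit) swap_swap)
  have "form F (v,u) = - form F (u,v)" for u v using 1[of "(u,v)"] by simp
  moreover have "form F p = 0" if "p \<notin> oedges X" for p
  proof -
    have "prod.swap p \<notin> oedges X" using that oedges_commute by (metis prod.swap_def surjective_pairing)
    then show ?thesis using that ed_oedges by (auto simp: form_def)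
  qed
  ultimately show ?thesis by (rule Omega1I)
qed

end

section \<open>The infinite complex\<close>

lemma upper_lap_diff: "upper_lap X (\<lambda>p. f p - g p) e = upper_lap X f e - upper_lap X g e"
  by (simp add: upper_lap_def diff_divide_distrib sum_subtractf)

lemma Omega1_zero: "(\<lambda>p. 0) \<in> Omega1 X"
  by (rule Omega1I) simp_all

lemma Omega1_diff: 
  assumes "f \<in> Omega1 X" "g \<in> Omega1 X" shows "(\<lambda>p. a * f p - b * g p) \<in> Omega1 X"
proof (rule Omega1I)
  fix u v show "a * f (v,u) - b * g (v,u) = - (a * f (u,v) - b * g (u,v))"
    using Omega1_flip[OF assms(1), of v u] Omega1_flip[OF assms(2), of v u] by simp
next
  fix p assume "p \<notin> oedges X"
  then show "a * f p - b * g p = 0" using Omega1_outside assms by (metis diff_self mult_zero_right)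
qed

lemma inc_sq: "inc t c * inc t c = 1"
  by (cases c rule: code_cases) (auto simp: inc_def)

lemma card_sides: "card (sides t) = 3"
  by (cases t) (auto simp: card_insert_if)

lemma ecodes_T22: "ecodes T22 = codes"
  by (auto simp: ecodes_def edge_in_T22)

lemma fcodes_T22: "fcodes T22 = tcodes"
  by (auto simp: fcodes_def face_in_T22)

lemma cofaces_T22: "c \<in> codes \<Longrightarrow> cofaces T22 c = {up c, Some c}"
  by (auto simp: cofaces_eq fcodes_T22 up_in_tcodes)

lemma cdeg_T22: "c \<in> codes \<Longrightarrow> cdeg T22 c = 2"
  by (simp add: cdeg_def cofaces_T22)

interpretation T: subcomplex T22
proof
  show "T22 \<subseteq> T22" by simp
  show "s' \<in> T22" if "s \<in> T22" "s' \<subseteq> s" for s s' using that unfolding T22_iff by blast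
  show "cofaces T22 c \<noteq> {}" if "c \<in> ecodes T22" for c
    using that by (simp add: ecodes_T22 cofaces_T22)
qed

section \<open>Nonnegativity of the spectrum on the infinite complex\<close>

definition lapT :: "(code \<Rightarrow> real) \<Rightarrow> code \<Rightarrow> real" where
  "lapT F c = bdry T22 (curl (\<lambda>c. F c / 2)) c"

definition reflT :: "(code \<Rightarrow> real) \<Rightarrow> code \<Rightarrow> real" where
  "reflT F c = 3/2 * F c - lapT F c"

lemma upper_lap_lapT:
  assumes "f \<in> Omega1 T22" "c \<in> codes"
  shows "upper_lap T22 f (ed c) = lapT (\<lambda>c. f (ed c)) c"
proof -
  have "curl (\<lambda>c. f (ed c) / cdeg T22 c) t = curl (\<lambda>c. f (ed c) / 2) t" if "t \<in> cofaces T22 c" for t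
  proof -
    have "t \<in> tcodes" using that by (auto simp: cofaces_def fcodes_def)
    then show ?thesis unfolding curl_def
      by (intro sum.cong) (use sides_codes cdeg_T22 in auto)
  qed
  then have "bdry T22 (curl (\<lambda>c. f (ed c) / cdeg T22 c)) c = lapT (\<lambda>c. f (ed c)) c"
    unfolding bdry_def lapT_def by (intro sum.cong) auto
  then show ?thesis using T.upper_lap_ed[OF assms(1)] assms(2) by (simp add: ecodes_T22)
qed

text \<open>On each triangle, \<open>3/2 - inc inc\<^sup>T\<close> is \<open>3/2\<close> times a reflection. Summing over triangles
  bounds the norm of \<open>3/2 - \<Delta>\<^sup>+\<close> by \<open>3/2\<close>, hence the spectrum is nonnegative.\<close>
lemma triangle_block:
  "(\<Sum>c\<in>sides t. (3/2 * g c - inc t c * curl g t)\<^sup>2) = 9/4 * (\<Sum>c\<in>sides t. (g c)\<^sup>2)"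
proof -
  let ?b = "curl g t"
  have "(3/2 * g c - inc t c * ?b)\<^sup>2 = 9/4 * (g c)\<^sup>2 - 3 * ?b * (inc t c * g c) + ?b\<^sup>2" for c
  proof -
    have "(3/2 * g c - inc t c * ?b)\<^sup>2 = 9/4 * (g c)\<^sup>2 - 3 * ?b * (inc t c * g c) + (inc t c * inc t c) * ?b\<^sup>2"
      by (simp add: power2_eq_square algebra_simps)
    then show ?thesis by (simp add: inc_sq)
  qed
  then have "(\<Sum>c\<in>sides t. (3/2 * g c - inc t c * ?b)\<^sup>2) =
    9/4 * (\<Sum>c\<in>sides t. (g c)\<^sup>2) - 3 * ?b * ?b + 3 * ?b\<^sup>2"
    by (simp only: sum.distrib sum_subtractf sum_distrib_left[symmetric] sum_constant card_sides 
        curl_def[of g, symmetric] of_nat_numeral)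
  then show ?thesis by (simp add: power2_eq_square)
qed

text \<open>\<open>reflT F\<close> at an edge is the sum of the contributions of its two triangles.
  The inequality \<open>(x+y)^2 \<le> 2(x^2+y^2)\<close> costs a factor 2, and each edge of
  \<open>B\<close> is counted at most twice; with \<open>g = F/2\<close> both factors cancel against
  1/4 and 9/4 from \<open>triangle_block\<close> remains. Staying with finite sets avoids
  rearranging infinite sums.\<close>

lemma reflT_finite_bound:
  assumes "finite A" "A \<subseteq> codes"
  obtains B where "finite B" "B \<subseteq> codes" 
    "(\<Sum>c\<in>A. (reflT F c)\<^sup>2) \<le> 9/4 * (\<Sum>c\<in>B. (F c)\<^sup>2)"
proof -
  define g where "g = (\<lambda>c. F c / 2)"
  define k where "k t c = 3/2 * g c - inc t c * curl g t" for t c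
  define TT where "TT = (\<Union>c\<in>A. cofaces T22 c)"
  define B where "B = (\<Union>t\<in>TT. sides t)"
  have TT: "finite TT" "TT \<subseteq> tcodes" using assms finite_cofaces unfolding TT_def cofaces_def fcodes_def by auto
  have B: "finite B" "B \<subseteq> codes" using TT sides_codes unfolding B_def by auto
  have sq: "(reflT F c)\<^sup>2 \<le> 2 * (\<Sum>t\<in>{t\<in>TT. c \<in> sides t}. (k t c)\<^sup>2)" if c: "c \<in> A" for c
  proof -
    have cc: "c \<in> codes" using c assms by auto
    have "{t\<in>TT. c \<in> sides t} = cofaces T22 c"
      using c unfolding TT_def cofaces_def by auto
    then have e: "{t\<in>TT. c \<in> sides t} = {up c, Some c}" using cofaces_T22[OF cc] by simp
    have "reflT F c = k (up c) c + k (Some c) c"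
      using cofaces_T22[OF cc] by (simp add: reflT_def lapT_def bdry_def k_def g_def)
    moreover have "(x + y)\<^sup>2 \<le> 2 * (x\<^sup>2 + y\<^sup>2)" for x y :: real
      using sum_squares_bound[of x y] by (simp add: power2_sum)
    ultimately show ?thesis unfolding e by simp
  qed
  have "(\<Sum>c\<in>A. (reflT F c)\<^sup>2) \<le> (\<Sum>c\<in>A. 2 * (\<Sum>t\<in>{t\<in>TT. c \<in> sides t}. (k t c)\<^sup>2))"
    by (intro sum_mono sq)
  also have "\<dots> = 2 * (\<Sum>t\<in>TT. \<Sum>c\<in>{c\<in>A. c \<in> sides t}. (k t c)\<^sup>2)"
    using sum.swap_restrict[OF assms(1) TT(1), of "\<lambda>c t. (k t c)\<^sup>2" "\<lambda>c t. c \<in> sides t"]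
    by (simp add: sum_distrib_left[symmetric])
  also have "\<dots> \<le> 2 * (\<Sum>t\<in>TT. \<Sum>c\<in>sides t. (k t c)\<^sup>2)"
    by (intro mult_left_mono sum_mono sum_mono2) auto
  also have "\<dots> = 9/2 * (\<Sum>t\<in>TT. \<Sum>c\<in>sides t. (g c)\<^sup>2)"
    unfolding k_def triangle_block by (simp add: sum_distrib_left)
  also have "(\<Sum>t\<in>TT. \<Sum>c\<in>sides t. (g c)\<^sup>2) = (\<Sum>t\<in>TT. \<Sum>c\<in>{c\<in>B. c \<in> sides t}. (g c)\<^sup>2)"
    by (intro sum.cong) (auto simp: B_def)
  also have "\<dots> = (\<Sum>c\<in>B. \<Sum>t\<in>{t\<in>TT. c \<in> sides t}. (g c)\<^sup>2)"
    by (rule sum.swap_restrict[OF TT(1) B(1)])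
  also have "\<dots> \<le> (\<Sum>c\<in>B. 2 * (g c)\<^sup>2)"
  proof (rule sum_mono)
    fix c assume "c \<in> B"
    then have "{t\<in>TT. c \<in> sides t} \<subseteq> {up c, Some c}" using B in_sides_iff by blast
    then have "card {t\<in>TT. c \<in> sides t} \<le> 2"
      using card_mono[of "{up c, Some c}" "{t\<in>TT. c \<in> sides t}"] by simp
    then have "real (card {t\<in>TT. c \<in> sides t}) * (g c)\<^sup>2 \<le> 2 * (g c)\<^sup>2"
      by (intro mult_right_mono) auto
    then show "(\<Sum>t\<in>{t\<in>TT. c \<in> sides t}. (g c)\<^sup>2) \<le> 2 * (g c)\<^sup>2" by simp
  qed
  also have "9/2 * (\<Sum>c\<in>B. 2 * (g c)\<^sup>2) = 9/4 * (\<Sum>c\<in>B. (F c)\<^sup>2)"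
    by (simp add: g_def sum_distrib_left power2_eq_square field_simps)
  finally have "(\<Sum>c\<in>A. (reflT F c)\<^sup>2) \<le> 9/4 * (\<Sum>c\<in>B. (F c)\<^sup>2)" by simp
  with B that show thesis by blast
qed

text \<open>A norm bound tested on finite subsets: it needs no summability side conditions and
  survives pointwise limits.\<close>

definition l2_le :: "(code \<Rightarrow> real) \<Rightarrow> real \<Rightarrow> bool" where
  "l2_le F B \<longleftrightarrow> (\<forall>A. finite A \<longrightarrow> A \<subseteq> codes \<longrightarrow> L2_set F A \<le> B)"

lemma l2_leD: "l2_le F B \<Longrightarrow> finite A \<Longrightarrow> A \<subseteq> codes \<Longrightarrow> L2_set F A \<le> B"
  by (simp add: l2_le_def)

lemma l2_le_nonneg: "l2_le F B \<Longrightarrow> 0 \<le> B"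
  using l2_leD[of F B "{}"] by simp

lemma l2_le_abs: "l2_le F B \<Longrightarrow> c \<in> codes \<Longrightarrow> \<bar>F c\<bar> \<le> B"
  using l2_leD[of F B "{c}"] by simp

lemma l2_le_mult: 
  assumes "l2_le F B" shows "l2_le (\<lambda>c. a * F c) (\<bar>a\<bar> * B)"
proof -
  have "L2_set (\<lambda>c. a * F c) A = \<bar>a\<bar> * L2_set F A" for A
    by (simp add: L2_set_def power_mult_distrib sum_distrib_left[symmetric] real_sqrt_mult)
  then show ?thesis using assms by (simp add: l2_le_def mult_left_mono)
qed

lemma l2_le_add: 
  assumes "l2_le F B" "l2_le G B'" shows "l2_le (\<lambda>c. F c + G c) (B + B')"
  unfolding l2_le_def
proof (intro allI impI)
  fix A assume A: "finite A" "A \<subseteq> codes"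
  have "L2_set (\<lambda>c. F c + G c) A \<le> L2_set F A + L2_set G A" by (rule L2_set_triangle_ineq)
  also have "\<dots> \<le> B + B'" using assms A by (intro add_mono l2_leD)
  finally show "L2_set (\<lambda>c. F c + G c) A \<le> B + B'" .
qed

lemma l2_le_cong:
  assumes "\<And>c. c \<in> codes \<Longrightarrow> F c = G c" "l2_le F B" shows "l2_le G B"
  using assms unfolding l2_le_def by (metis L2_set_cong subsetD)

lemma l2_le_reflT: assumes "l2_le F B" shows "l2_le (reflT F) (3/2 * B)"
  unfolding l2_le_def
proof (intro allI impI)
  fix A assume "finite A" "A \<subseteq> codes"
  then obtain B' where B': "finite B'" "B' \<subseteq> codes"
    "(\<Sum>c\<in>A. (reflT F c)\<^sup>2) \<le> 9/4 * (\<Sum>c\<in>B'. (F c)\<^sup>2)" using reflT_finite_bound by blast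
  have "L2_set (reflT F) A \<le> sqrt ((3/2)\<^sup>2 * (\<Sum>c\<in>B'. (F c)\<^sup>2))"
    unfolding L2_set_def using B'(3) by (intro real_sqrt_le_mono) (simp add: power2_eq_square)
  also have "\<dots> = 3/2 * L2_set F B'" unfolding real_sqrt_mult L2_set_def by simp
  also have "\<dots> \<le> 3/2 * B" using l2_leD[OF assms] B' by simp
  finally show "L2_set (reflT F) A \<le> 3/2 * B" .
qed

lemma L2_T22_iff:
  "f \<in> Omega1_L2 T22 \<longleftrightarrow> f \<in> Omega1 T22 \<and> (\<exists>B. l2_le (\<lambda>c. f (ed c)) B)"
proof -
  have "(\<lambda>c. (f (ed c))\<^sup>2 / cdeg T22 c) summable_on codes \<longleftrightarrow> (\<lambda>c. (f (ed c))\<^sup>2) summable_on codes"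
  proof -
    have "(\<lambda>c. (f (ed c))\<^sup>2 / cdeg T22 c) summable_on codes \<longleftrightarrow> (\<lambda>c. (f (ed c))\<^sup>2 * (1/2)) summable_on codes"
      by (rule summable_on_cong) (simp add: cdeg_T22)
    also have "\<dots> \<longleftrightarrow> (\<lambda>c. (f (ed c))\<^sup>2) summable_on codes"
      by (rule summable_on_cmult_left') simp
    finally show ?thesis .
  qed
  also have "\<dots> \<longleftrightarrow> (\<exists>B. l2_le (\<lambda>c. f (ed c)) B)"
  proof
    assume s: "(\<lambda>c. (f (ed c))\<^sup>2) summable_on codes"
    have "l2_le (\<lambda>c. f (ed c)) (sqrt (\<Sum>\<^sub>\<infinity>c\<in>codes. (f (ed c))\<^sup>2))"
      unfolding l2_le_def L2_set_def
      by (auto intro!: real_sqrt_le_mono finite_sum_le_infsum s)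
    then show "\<exists>B. l2_le (\<lambda>c. f (ed c)) B" ..
  next
    assume "\<exists>B. l2_le (\<lambda>c. f (ed c)) B"
    then obtain B where B: "l2_le (\<lambda>c. f (ed c)) B" ..
    have "(\<Sum>c\<in>A. (f (ed c))\<^sup>2) \<le> B\<^sup>2" if "finite A" "A \<subseteq> codes" for A
      using l2_leD[OF B that] unfolding L2_set_def by (rule sqrt_le_D)
    then show "(\<lambda>c. (f (ed c))\<^sup>2) summable_on codes"
      by (intro nonneg_bdd_above_summable_on bdd_aboveI2) auto
  qed
  finally show ?thesis by (simp add: T.L2_codes ecodes_T22)
qed

lemma reflT_tendsto:
  assumes "\<And>c. c \<in> codes \<Longrightarrow> (\<lambda>n. F n c) \<longlonglongrightarrow> G c" "c \<in> codes"
  shows "(\<lambda>n. reflT (F n) c) \<longlonglongrightarrow> reflT G c"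
proof -
  have "(\<lambda>n. curl (\<lambda>c. F n c / 2) t) \<longlonglongrightarrow> curl (\<lambda>c. G c / 2) t" if "t \<in> tcodes" for t
    unfolding curl_def using that sides_codes by (intro tendsto_intros assms(1)) auto
  then show ?thesis unfolding reflT_def lapT_def bdry_def
    by (intro tendsto_intros assms) (auto simp: cofaces_def fcodes_def)
qed

lemma reflT_diff: "reflT (\<lambda>c. F c - G c) c = reflT F c - reflT G c"
  unfolding reflT_def lapT_def bdry_def curl_def
  by (simp add: diff_divide_distrib right_diff_distrib sum_subtractf)

lemma reflT_cong: 
  assumes "\<And>c. c \<in> codes \<Longrightarrow> F c = G c" "c \<in> codes"
  shows "reflT F c = reflT G c"
proof -
  \<comment> \<open>Agreement on \<open>codes\<close> is convergence of a constant sequence, so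
    locality of \<open>reflT\<close> need not be proved again.\<close>
  have "(\<lambda>n::nat. reflT F c) \<longlonglongrightarrow> reflT G c" using reflT_tendsto[of "\<lambda>_. F" G c] assms by simp
  then show ?thesis using LIMSEQ_unique tendsto_const by blast
qed

text \<open>The equation reads \<open>m * F = G + reflT F\<close> with
  \<open>m = 3/2 - \<mu>\<close>. As \<open>reflT\<close> has norm at most 3/2 and
  \<open>m > 3/2\<close>, fixed-point iteration contracts with ratio
  \<open>q = (3/2)/m\<close>.\<close>

lemma resolvent_surj:
  assumes mu: "\<mu> < 0" and G: "l2_le G B0"
  obtains F B where "l2_le F B" "\<And>c. c \<in> codes \<Longrightarrow> lapT F c - \<mu> * F c = G c"
proof -
  define m where "m = 3/2 - \<mu>"
  have m: "m > 3/2" using mu by (simp add: m_def)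
  define S where "S n = ((\<lambda>F c. (G c + reflT F c) / m) ^^ n) (\<lambda>_. 0)" for n
  have S0: "S 0 = (\<lambda>_. 0)" by (simp add: S_def)
  have SS: "S (Suc n) c = (G c + reflT (S n) c) / m" for n c by (simp add: S_def)
  \<comment> \<open>The solution of \<open>K = (B0 + 3/2 * K)/m\<close>, hence a bound that the
    iteration preserves.\<close>
  define K where "K = B0 / (m - 3/2)"
  have K: "(B0 + 3/2 * K) / m = K" using m by (simp add: K_def field_simps)
  have bS: "l2_le (S n) K" for n
  proof (induction n)
    case 0
    then show ?case using l2_le_nonneg[OF G] m by (simp add: S0 l2_le_def L2_set_def K_def)
  next
    case (Suc n)
    have "l2_le (\<lambda>c. 1/m * (G c + reflT (S n) c)) (\<bar>1/m\<bar> * (B0 + 3/2 * K))"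
      by (intro l2_le_mult l2_le_add G l2_le_reflT Suc)
    moreover have "\<bar>1/m\<bar> * (B0 + 3/2 * K) = K" using K m by simp
    moreover have "S (Suc n) = (\<lambda>c. 1/m * (G c + reflT (S n) c))" using SS by auto
    ultimately show ?case by simp
  qed
  define q where "q = 3/2 / m"
  have q: "0 < q" "q < 1" using m by (auto simp: q_def)
  have bD: "l2_le (\<lambda>c. S (Suc n) c - S n c) (K * q ^ n)" for n
  proof (induction n)
    case 0 then show ?case using bS[of 1] by (simp add: S0)
  next
    case (Suc n)
    have "l2_le (\<lambda>c. 1/m * reflT (\<lambda>c. S (Suc n) c - S n c) c) (\<bar>1/m\<bar> * (3/2 * (K * q ^ n)))"
      by (intro l2_le_mult l2_le_reflT Suc)
    moreover have "\<bar>1/m\<bar> * (3/2 * (K * q ^ n)) = K * q ^ Suc n" using m by (simp add: q_def)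
    moreover have "(\<lambda>c. S (Suc (Suc n)) c - S (Suc n) c) = (\<lambda>c. 1/m * reflT (\<lambda>c. S (Suc n) c - S n c) c)"
      unfolding reflT_diff SS[of "Suc n"] SS[of n] by (auto simp: diff_divide_distrib[symmetric])
    ultimately show ?case by simp
  qed
  have "convergent (\<lambda>n. S n c)" if c: "c \<in> codes" for c
  proof -
    have "summable (\<lambda>n. S (Suc n) c - S n c)"
    proof (rule summable_comparison_test)
      show "\<exists>N. \<forall>n\<ge>N. norm (S (Suc n) c - S n c) \<le> K * q ^ n"
        using l2_le_abs[OF bD c] by auto
      show "summable (\<lambda>n. K * q ^ n)" using q by (intro summable_mult summable_geometric) auto
    qed
    then have "convergent (\<lambda>n. \<Sum>k<n. S (Suc k) c - S k c)" by (simp add: summable_iff_convergent)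
    moreover have "(\<Sum>k<n. S (Suc k) c - S k c) = S n c" for n
      using sum_lessThan_telescope[of "\<lambda>n. S n c" n] by (simp add: S0)
    ultimately show ?thesis by simp
  qed
  then obtain F where F: "(\<lambda>n. S n c) \<longlonglongrightarrow> F c" if "c \<in> codes" for c
    unfolding convergent_def by metis
  have "l2_le F K" unfolding l2_le_def
  proof (intro allI impI)
    fix A assume A: "finite A" "A \<subseteq> codes"
    have "(\<lambda>n. L2_set (S n) A) \<longlonglongrightarrow> L2_set F A"
      unfolding L2_set_def using A F by (intro tendsto_intros) auto
    then show "L2_set F A \<le> K" using l2_leD[OF bS A] by (intro LIMSEQ_le_const2) auto
  qed
  moreover have "lapT F c - \<mu> * F c = G c" if c: "c \<in> codes" for c
  proof -
    have "(\<lambda>n. S (Suc n) c) \<longlonglongrightarrow> (G c + reflT F c) / m"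
      unfolding SS using m by (intro tendsto_intros reflT_tendsto F c) auto
    moreover have "(\<lambda>n. S (Suc n) c) \<longlonglongrightarrow> F c" using F[OF c] by (rule LIMSEQ_Suc)
    ultimately have "F c = (G c + reflT F c) / m" using LIMSEQ_unique by blast
    then have "m * F c = G c + reflT F c" using m by (simp add: field_simps)
    then show ?thesis by (simp add: m_def reflT_def algebra_simps)
  qed
  ultimately show thesis using that by blast
qed

text \<open>A solution satisfies \<open>F = reflT F / m\<close>, so any norm bound improves by the
  factor \<open>q < 1\<close> as often as desired.\<close>

lemma resolvent_inj:
  assumes mu: "\<mu> < 0" and F: "l2_le F B" and eq: "\<And>c. c \<in> codes \<Longrightarrow> lapT F c = \<mu> * F c"
    and c: "c \<in> codes"
  shows "F c = 0"
proof -
  define m where "m = 3/2 - \<mu>"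
  have m: "m > 3/2" using mu by (simp add: m_def)
  define q where "q = 3/2 / m"
  have q: "0 < q" "q < 1" using m by (auto simp: q_def)
  have "l2_le F (B * q ^ n)" for n
  proof (induction n)
    case (Suc n)
    have "l2_le (\<lambda>c. 1/m * reflT F c) (\<bar>1/m\<bar> * (3/2 * (B * q ^ n)))"
      by (intro l2_le_mult l2_le_reflT Suc)
    moreover have "\<bar>1/m\<bar> * (3/2 * (B * q ^ n)) = B * q ^ Suc n" using m by (simp add: q_def)
    moreover have "1/m * reflT F c = F c" if "c \<in> codes" for c
      using eq[OF that] m by (simp add: reflT_def m_def field_simps)
    ultimately show ?case using l2_le_cong by metis
  qed (simp add: F)
  then have "\<bar>F c\<bar> \<le> B * q ^ n" for n using l2_le_abs c by blast
  moreover have "(\<lambda>n. B * q ^ n) \<longlonglongrightarrow> B * 0"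
    using q by (intro tendsto_intros LIMSEQ_realpow_zero) auto
  ultimately have "\<bar>F c\<bar> \<le> B * 0" by (intro LIMSEQ_le_const[of _ "B * 0"]) auto
  then show ?thesis by simp
qed

section \<open>Gradients on the infinite complex\<close>

lemma fst_ed_replicate: "fst (ed (i, replicate n False @ bs)) = fst (ed (i,bs))"
proof (induction n)
  case (Suc n)
  have "(i, replicate (Suc n) False @ bs) = child False (i, replicate n False @ bs)" by (simp add: child_def)
  then show ?case using Suc by (simp only: ed_child) simp
qed simp

text \<open>A vertex is wanted as a first end because \<open>fst_ed_replicate\<close> then supplies
  infinitely many edges starting there. Passing to \<open>child True c\<close> turns a second end
  into a first end.\<close>

lemma verts_T22_fst:
  assumes "v \<in> verts T22" obtains c where "c \<in> codes" "v = fst (ed c)"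
proof -
  have *: thesis if "c \<in> codes" "v = fst (ed c) \<or> v = snd (ed c)" for c
    using that \<open>\<And>c. c \<in> codes \<Longrightarrow> v = fst (ed c) \<Longrightarrow> thesis\<close>[of c] 
      \<open>\<And>c. c \<in> codes \<Longrightarrow> v = fst (ed c) \<Longrightarrow> thesis\<close>[of "child True c"] by auto
  obtain t where t: "t \<in> tcodes" "v \<in> face t" using assms unfolding verts_def T22_iff by auto
  show thesis
  proof (cases t)
    case None
    then have "v = R 0 \<or> v = R 1 \<or> v = R 2" using t by auto
    then show thesis using *[of "(0,[])"] *[of "(1,[])"] by (auto simp: Nil_in_codes)
  next
    case (Some c)
    then show thesis using t *[of c] *[of "child True c"] by (auto simp: edge_def)
  qed
qed

lemma snd_ed_vert: "c \<in> codes \<Longrightarrow> snd (ed c) \<in> verts T22"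
  using edge_in_T22[of c] T.down[of "edge c" "{snd (ed c)}"] by (auto simp: verts_def edge_def)

text \<open>Every vertex of the infinite complex has infinitely many neighbours, so a nonzero
  square-summable function on the vertices has infinite energy.\<close>
lemma B1_T22: assumes "g \<in> B1 T22" shows "g p = 0"
proof -
  obtain \<phi> where \<phi>: "\<phi> \<in> Omega0_L2 T22" "g = delta1 T22 \<phi>" and g: "g \<in> Omega1_L2 T22"
    using assms by (auto simp: B1_def)
  have ps: "(\<lambda>v. (\<phi> v)\<^sup>2) summable_on verts T22" using \<phi> by (simp add: Omega0_L2_def)
  have gs: "(\<lambda>c. (g (ed c))\<^sup>2 / cdeg T22 c) summable_on codes"
    using g by (simp add: T.L2_codes ecodes_T22)
  have to0: "(\<lambda>n::nat. f (s n)) \<longlonglongrightarrow> 0" if "f summable_on A" "inj s" "range s \<subseteq> A" 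
    for f :: "'b \<Rightarrow> real" and s A
  proof -
    have "f summable_on range s" using that summable_on_subset_banach by blast
    then have "(f \<circ> s) summable_on UNIV" using that by (simp add: summable_on_reindex)
    then have "summable (f \<circ> s)" by (rule summable_on_imp_summable)
    then show ?thesis using summable_LIMSEQ_zero by (simp add: o_def)
  qed
  have "\<phi> v = 0" if v: "v \<in> verts T22" for v
  proof -
    obtain c where c: "c \<in> codes" "v = fst (ed c)" using verts_T22_fst[OF v] by blast
    \<comment> \<open>Infinitely many different edges starting at \<open>v\<close>, whose other ends
      are also pairwise different.\<close>
    define s where "s n = (fst c, replicate (Suc n) False @ snd c)" for n
    have s: "s n \<in> codes" "fst (ed (s n)) = v" for n
      using c fst_ed_replicate[of "fst c" "Suc n" "snd c"] by (auto simp: s_def codes_def)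
    have s2: "snd (ed (s n)) = N (fst c) (replicate n False @ snd c)" for n
    proof -
      have "s n = child False (fst c, replicate n False @ snd c)" by (simp add: s_def child_def)
      then show ?thesis by (simp only: ed_child) simp
    qed
    have inj: "inj s" "inj (\<lambda>n. snd (ed (s n)))" unfolding s2 by (auto simp: inj_def s_def dest: arg_cong[of _ _ length])
    have ge: "(g (ed (s n)))\<^sup>2 / cdeg T22 (s n) = 2 * (\<phi> (snd (ed (s n))) - \<phi> v)\<^sup>2" for n
    proof -
      have "ed (s n) \<in> oedges T22" using T.ed_oedges s by (simp add: ecodes_T22)
      then have "g (ed (s n)) = 2 * (\<phi> (snd (ed (s n))) - \<phi> v)" 
        using s \<phi>(2) edeg_ed[OF T.sub s(1), of n] cdeg_T22[OF s(1), of n] by (simp add: delta1_def)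
      then show ?thesis unfolding cdeg_T22[OF s(1)] by (simp only: power_mult_distrib) simp
    qed
    have "(\<lambda>n. 2 * (\<phi> (snd (ed (s n))) - \<phi> v)\<^sup>2) \<longlonglongrightarrow> 0"
      using to0[OF gs inj(1)] s(1) unfolding ge by auto
    then have "(\<lambda>n. 1/2 * (2 * (\<phi> (snd (ed (s n))) - \<phi> v)\<^sup>2)) \<longlonglongrightarrow> 1/2 * 0" by (intro tendsto_intros)
    then have 1: "(\<lambda>n. \<phi> (snd (ed (s n))) - \<phi> v) \<longlonglongrightarrow> 0"
      by simp
    have "(\<lambda>n. (\<phi> (snd (ed (s n))))\<^sup>2) \<longlonglongrightarrow> 0" 
      by (rule to0[OF ps inj(2)]) (use snd_ed_vert[OF s(1)] in blast)
    then have 2: "(\<lambda>n. \<phi> (snd (ed (s n)))) \<longlonglongrightarrow> 0" by simp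
    \<comment> \<open>Along these edges the increments tend to 0 by finite energy, and the values at
      the far ends by square-summability; only \<open>\<phi> v = 0\<close> is compatible with
      both.\<close>
    have "(\<lambda>n. \<phi> (snd (ed (s n))) - (\<phi> (snd (ed (s n))) - \<phi> v)) \<longlonglongrightarrow> 0 - 0"
      by (intro tendsto_diff 1 2)
    then show "\<phi> v = 0" by (simp add: LIMSEQ_const_iff)
  qed
  moreover have "\<phi> v = 0" if "v \<notin> verts T22" for v using \<phi> that by (simp add: Omega0_L2_def Omega0_def)
  ultimately have "\<phi> v = 0" for v by blast
  then show ?thesis using \<phi>(2) by (simp add: delta1_def)
qed

lemma Z1_T22: "Z1 T22 = Omega1_L2 T22"
  by (auto simp: Z1_def inner1_def B1_T22)

lemma bij_resolvent_T22:
  assumes "\<mu> < 0"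
  shows "bij_betw (\<lambda>f e. upper_lap T22 f e - \<mu> * f e) (Omega1_L2 T22) (Omega1_L2 T22)"
    (is "bij_betw ?D ?L ?L")
proof (rule bij_betw_imageI)
  have DO: "?D f \<in> Omega1 T22" if "f \<in> Omega1 T22" for f
    using Omega1_diff[OF T.upper_lap_in[OF that] that, of 1 \<mu>] by simp
  have De: "?D f (ed c) = lapT (\<lambda>c. f (ed c)) c - \<mu> * f (ed c)" if "f \<in> Omega1 T22" "c \<in> codes" for f c
    using upper_lap_lapT[OF that] by simp
  show "inj_on ?D ?L"
  proof (rule inj_onI)
    fix f g assume f: "f \<in> ?L" and g: "g \<in> ?L" and e: "?D f = ?D g"
    obtain B where B: "l2_le (\<lambda>c. f (ed c)) B" using f L2_T22_iff by blast
    obtain B' where B': "l2_le (\<lambda>c. g (ed c)) B'" using g L2_T22_iff by blast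
    define h where "h p = f p - g p" for p
    have fO: "f \<in> Omega1 T22" "g \<in> Omega1 T22" using f g L2_T22_iff by blast+
    then have hO: "h \<in> Omega1 T22" using Omega1_diff[of f T22 g 1 1] by (simp add: h_def[abs_def])
    have "l2_le (\<lambda>c. f (ed c) + (-1) * g (ed c)) (B + \<bar>-1\<bar> * B')"
      by (intro l2_le_add l2_le_mult B B')
    then have hb: "l2_le (\<lambda>c. h (ed c)) (B + B')" by (simp add: h_def)
    have "h (ed c) = 0" if c: "c \<in> codes" for c
    proof (rule resolvent_inj[OF assms hb _ c])
      fix c :: code assume "c \<in> codes"
      have "upper_lap T22 h (ed c) = \<mu> * h (ed c)"
        using fun_cong[OF e, of "ed c"] unfolding h_def upper_lap_diff by (simp add: algebra_simps)
      then show "lapT (\<lambda>c. h (ed c)) c = \<mu> * h (ed c)" using upper_lap_lapT[OF hO \<open>c \<in> codes\<close>] by simp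
    qed
    then show "f = g" using fO by (intro T.Omega1_eqI) (auto simp: ecodes_T22 h_def)
  qed
  show "?D ` ?L = ?L"
  proof (intro set_eqI iffI)
    fix g assume "g \<in> ?D ` ?L"
    then obtain f where f: "f \<in> ?L" "g = ?D f" by auto
    then obtain B where B: "l2_le (\<lambda>c. f (ed c)) B" and fO: "f \<in> Omega1 T22" using L2_T22_iff by blast
    have "l2_le (\<lambda>c. (3/2 - \<mu>) * f (ed c) + (-1) * reflT (\<lambda>c. f (ed c)) c) (\<bar>3/2 - \<mu>\<bar> * B + \<bar>-1\<bar> * (3/2 * B))"
      by (intro l2_le_add l2_le_mult l2_le_reflT B)
    then have "l2_le (\<lambda>c. g (ed c)) (\<bar>3/2 - \<mu>\<bar> * B + \<bar>-1\<bar> * (3/2 * B))"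
      by (rule l2_le_cong[rotated]) (simp add: f(2) De[OF fO] upper_lap_lapT[OF fO] reflT_def algebra_simps)
    then show "g \<in> ?L" using DO[OF fO] f(2) L2_T22_iff by blast
  next
    fix g assume g: "g \<in> ?L"
    then obtain B where B: "l2_le (\<lambda>c. g (ed c)) B" and gO: "g \<in> Omega1 T22" using L2_T22_iff by blast
    obtain F K where F: "l2_le F K" "\<And>c. c \<in> codes \<Longrightarrow> lapT F c - \<mu> * F c = g (ed c)"
      using resolvent_surj[OF assms B] by metis
    define f where "f = T.form F"
    have fO: "f \<in> Omega1 T22" by (simp add: f_def T.form_Omega1)
    have fe: "f (ed c) = F c" if "c \<in> codes" for c using that by (simp add: f_def T.form_ed ecodes_T22)
    have "l2_le (\<lambda>c. f (ed c)) K" by (rule l2_le_cong[OF _ F(1)]) (simp add: fe)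
    then have fL: "f \<in> ?L" using fO L2_T22_iff by blast
    have "lapT (\<lambda>c. f (ed c)) c = lapT F c" if "c \<in> codes" for c
      using reflT_cong[of "\<lambda>c. f (ed c)" F c] fe that by (simp add: reflT_def)
    then have "?D f (ed c) = g (ed c)" if "c \<in> ecodes T22" for c
      using F(2)[of c] fe[of c] De[OF fO, of c] that by (simp add: ecodes_T22)
    then have "?D f = g" by (rule T.Omega1_eqI[OF DO[OF fO] gO])
    then show "g \<in> ?D ` ?L" using fL by blast
  qed
qed

text \<open>A closed square-summable 1-form: halve the value when passing from an edge to the two new
  edges of the triangle below it.\<close>
fun halving :: "bool list \<Rightarrow> real" where
  "halving [] = 1"
| "halving (b # bs) = (if b then - halving bs / 2 else halving bs / 2)"

text \<open>Two continuations, each with a quarter of the square: the sums satisfy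
  \<open>s (n+1) = 1 + s n / 2\<close>, whose fixed point is 2.\<close>

lemma halving_bound: "(\<Sum>bs\<in>{bs. length bs \<le> n}. (halving bs)\<^sup>2) \<le> 2"
proof (induction n)
  case (Suc n)
  let ?L = "{bs :: bool list. length bs \<le> n}"
  have fin: "finite ?L" using finite_lists_length_le[of "UNIV :: bool set" n] by simp
  have e: "{bs :: bool list. length bs \<le> Suc n} = insert [] ((#) True ` ?L \<union> (#) False ` ?L)"
  proof (intro set_eqI iffI)
    fix bs :: "bool list" assume "bs \<in> {bs. length bs \<le> Suc n}"
    then show "bs \<in> insert [] ((#) True ` ?L \<union> (#) False ` ?L)"
      by (cases bs) (auto simp: image_iff)
  qed auto
  have "(\<Sum>bs\<in>{bs. length bs \<le> Suc n}. (halving bs)\<^sup>2) = 1 + 2 * (\<Sum>bs\<in>?L. (halving bs)\<^sup>2 / 4)"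
    unfolding e using fin 
    by (subst sum.insert, simp, force, subst sum.union_disjoint) (auto simp: sum.reindex power_divide)
  also have "\<dots> = 1 + (\<Sum>bs\<in>?L. (halving bs)\<^sup>2) / 2" by (simp add: sum_divide_distrib[symmetric])
  finally show ?case using Suc by simp
qed simp

lemma zero_in_spec_T22: "0 \<in> spec_Z1 T22"
proof -
  \<comment> \<open>Branches 0 and 1 enter the circulation around the initial triangle with opposite
    signs and cancel, so branch 2 is set to 0. The bound 4 below is 2 for each of the two nonzero
    branches.\<close>
  define F where "F c = (if fst c = 2 then 0 else halving (snd c))" for c :: code
  have Fb: "l2_le F (sqrt 4)"
    unfolding l2_le_def L2_set_def
  proof (intro allI impI real_sqrt_le_mono)
    fix A assume A: "finite A" "A \<subseteq> codes"
    define n where "n = Max (insert 0 ((length \<circ> snd) ` A))"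
    have n: "length (snd c) \<le> n" if "c \<in> A" for c unfolding n_def using A that by (intro Max_ge) auto
    let ?L = "{bs :: bool list. length bs \<le> n}"
    have fin: "finite ?L" using finite_lists_length_le[of "UNIV :: bool set" n] by simp
    have "A \<subseteq> {..<3} \<times> ?L" using A n by (auto simp: codes_def)
    then have "(\<Sum>c\<in>A. (F c)\<^sup>2) \<le> (\<Sum>c\<in>{..<3} \<times> ?L. (F c)\<^sup>2)" using fin by (intro sum_mono2) auto
    also have "\<dots> = (\<Sum>i<3. \<Sum>bs\<in>?L. (F (i,bs))\<^sup>2)" by (simp add: sum.cartesian_product)
    also have "\<dots> = 2 * (\<Sum>bs\<in>?L. (halving bs)\<^sup>2)" by (simp add: F_def eval_nat_numeral)
    also have "\<dots> \<le> 4" using halving_bound[of n] by simp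
    finally show "(\<Sum>c\<in>A. (F c)\<^sup>2) \<le> 4" .
  qed
  define f where "f = T.form F"
  have fe: "f (ed c) = F c" if "c \<in> codes" for c using that by (simp add: f_def T.form_ed ecodes_T22)
  have "l2_le (\<lambda>c. f (ed c)) (sqrt 4)" by (rule l2_le_cong[OF _ Fb]) (simp add: fe)
  then have fL: "f \<in> Omega1_L2 T22" using L2_T22_iff T.form_Omega1 by (auto simp: f_def)
  have "curl (\<lambda>c. F c / 2) t = 0" for t
    by (cases t) (auto simp: curl_simps F_def child_def)
  then have L0: "lapT F c = 0" for c by (simp add: lapT_def bdry_def)
  have "upper_lap T22 f = (\<lambda>p. 0)"
  proof (rule T.Omega1_eqI)
    fix c assume "c \<in> ecodes T22"
    then have c: "c \<in> codes" by (simp add: ecodes_T22)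
    have "lapT (\<lambda>c. f (ed c)) c = lapT F c"
      using reflT_cong[of "\<lambda>c. f (ed c)" F c] fe c by (simp add: reflT_def)
    then show "upper_lap T22 f (ed c) = 0" using L0 upper_lap_lapT[OF _ c] by (simp add: f_def T.form_Omega1)
  qed (simp_all add: f_def T.form_Omega1 T.upper_lap_in Omega1_zero)
  moreover have "upper_lap T22 (\<lambda>p. 0) = (\<lambda>p. 0)" by (auto simp: upper_lap_def)
  moreover have "(\<lambda>p. 0) \<in> Omega1_L2 T22" by (simp add: Omega1_L2_def Omega1_zero)
  moreover have "f \<noteq> (\<lambda>p. 0)" using fe[of "(0,[])"] by (auto simp: F_def Nil_in_codes)
  ultimately have "\<not> inj_on (\<lambda>f e. upper_lap T22 f e - 0 * f e) (Z1 T22)"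
    using inj_onD[of "\<lambda>f e. upper_lap T22 f e - 0 * f e" "Z1 T22" f "\<lambda>p. 0"] fL
    unfolding Z1_T22 by auto
  then show ?thesis by (auto simp: spec_Z1_def bij_betw_def)
qed

lemma spectral_gap_T22: "spectral_gap T22 = 0"
  unfolding spectral_gap_def
proof (rule cInf_eq_minimum[OF zero_in_spec_T22])
  fix \<mu> assume "\<mu> \<in> spec_Z1 T22"
  then show "0 \<le> \<mu>" using bij_resolvent_T22[of \<mu>] by (force simp: spec_Z1_def Z1_T22)
qed

section \<open>Finite subcomplexes\<close>

text \<open>The image of a basis is independent and equally large; a vector of \<open>V\<close>
  outside the image of \<open>T\<close> would enlarge it beyond the dimension of
  \<open>V\<close>.\<close>

lemma (in vector_space) inj_endo_surj_on_subspace: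
  assumes T: "Vector_Spaces.linear scale scale T" and V: "subspace V" "V \<subseteq> span D" "finite D"
    and TV: "T ` V \<subseteq> V" "inj_on T V"
  shows "T ` V = V"
proof -
  interpret t: Vector_Spaces.linear scale scale T by (rule T)
  obtain B where B: "B \<subseteq> V" "independent B" "V \<subseteq> span B" by (rule maximal_independent_subset)
  have sB: "span B = V" using B V(1) span_minimal[of B V] by blast
  have fB: "finite B" using independent_span_bound[OF V(3) B(2)] B(1) V(2) by blast
  have ind: "independent (T ` B)" using t.independent_injective_image[OF B(2)] TV(2) sB by simp
  have sT: "span (T ` B) = T ` V" using t.span_image[of B] sB by simp
  have "v \<in> T ` V" if v: "v \<in> V" for v
  proof (rule ccontr)
    assume n: "v \<notin> T ` V"
    then have "independent (insert v (T ` B))" using ind sT by (intro independent_insertI) simp_all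
    moreover have "insert v (T ` B) \<subseteq> span B" using v sB TV(1) B(1) by auto
    ultimately have "card (insert v (T ` B)) \<le> card B" using independent_span_bound[OF fB] by blast
    moreover have "v \<notin> T ` B" using n B(1) by blast
    moreover have "card (T ` B) = card B" using TV(2) B(1) inj_on_subset card_image by metis
    ultimately show False using fB by simp
  qed
  then show ?thesis using TV(1) by blast
qed

lemma vector_space_fun: "vector_space (\<lambda>(a::real) (f::'a \<Rightarrow> real). (\<lambda>x. a * f x))"
  by unfold_locales (auto simp: fun_eq_iff algebra_simps)

text \<open>Functions supported on \<open>A\<close> are combinations of the finitely many indicator
  functions of its points, which makes \<open>V\<close> finite-dimensional inside an arbitrary
  function space.\<close>

lemma finite_support_inj_imp_surj:
  fixes V :: "('a \<Rightarrow> real) set"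
  assumes "finite A" and supp: "\<And>f x. f \<in> V \<Longrightarrow> x \<notin> A \<Longrightarrow> f x = 0"
    and lin: "\<And>f g. T (\<lambda>x. f x + g x) = (\<lambda>x. T f x + T g x)" "\<And>a f. T (\<lambda>x. a * f x) = (\<lambda>x. a * T f x)"
    and V: "(\<lambda>x. 0) \<in> V" "\<And>f g. f \<in> V \<Longrightarrow> g \<in> V \<Longrightarrow> (\<lambda>x. f x + g x) \<in> V"
      "\<And>a f. f \<in> V \<Longrightarrow> (\<lambda>x. a * f x) \<in> V"
    and TV: "T ` V \<subseteq> V" "inj_on T V"
  shows "T ` V = V"
proof -
  let ?s = "\<lambda>(a::real) (f::'a \<Rightarrow> real). (\<lambda>x. a * f x)"
  interpret fv: vector_space ?s by (rule vector_space_fun)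
  let ?D = "(\<lambda>a x. if x = a then 1 else 0) ` A"
  show ?thesis
  proof (rule fv.inj_endo_surj_on_subspace[of T V ?D])
    show "Vector_Spaces.linear ?s ?s T"
      unfolding Vector_Spaces.linear_iff using lin vector_space_fun by (simp add: plus_fun_def)
    show "fv.subspace V" unfolding fv.subspace_def using V by (auto simp: plus_fun_def zero_fun_def)
    show "V \<subseteq> fv.span ?D"
    proof
      fix f assume f: "f \<in> V"
      have "f = (\<Sum>a\<in>A. ?s (f a) (\<lambda>x. if x = a then 1 else 0))"
      proof
        fix x
        have "(\<Sum>a\<in>A. ?s (f a) (\<lambda>x. if x = a then 1 else 0)) x = (\<Sum>a\<in>A. f a * (if x = a then 1 else 0))"
          using assms(1) by (induction A rule: finite_induct) auto
        also have "\<dots> = (\<Sum>a\<in>A. if x = a then f a else 0)" by (intro sum.cong) auto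
        also have "\<dots> = f x" using assms(1) supp[OF f, of x] by simp
        finally show "f x = (\<Sum>a\<in>A. ?s (f a) (\<lambda>x. if x = a then 1 else 0)) x" by simp
      qed
      also have "\<dots> \<in> fv.span ?D"
        by (intro fv.span_sum fv.span_scale fv.span_base) auto
      finally show "f \<in> fv.span ?D" .
    qed
  qed (use assms in auto)
qed

section \<open>Exactness of closed cochains\<close>

lemma curl_grad: "curl (\<lambda>c. \<phi> (snd (ed c)) - \<phi> (fst (ed c))) t = 0"
  by (cases t) (auto simp: curl_simps)

lemma curl_cong: 
  assumes "\<And>c. c \<in> sides t \<Longrightarrow> F c = G c" shows "curl F t = curl G t"
  unfolding curl_def using assms by simp

text \<open>A primitive of \<open>G\<close> is built outwards from the initial triangle: the new vertex of a triangle gets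
  its value along whichever of its two edges lies in \<open>E\<close>. The pair holds the values at the two ends
  of \<open>base i bs\<close>.\<close>
fun potential :: "code set \<Rightarrow> (code \<Rightarrow> real) \<Rightarrow> nat \<Rightarrow> bool list \<Rightarrow> real \<times> real" where
  "potential E G i [] = 
    (let a1 = (if (2,[]) \<in> E then G (2,[]) else 0);
         a2 = (if (1,[]) \<in> E then G (1,[]) else a1 + G (0,[]))
     in if i = 0 then (a1, a2) else if i = 1 then (0, a2) else (0, a1))"
| "potential E G i (b # bs) =
    ((if b then snd (potential E G i bs) else fst (potential E G i bs)),
     (if (i, False # bs) \<in> E then fst (potential E G i bs) + G (i, False # bs)
      else snd (potential E G i bs) + G (i, True # bs)))"

text \<open>The second component of \<open>potential E G i (b # bs)\<close> does not depend on
  \<open>b\<close>, so choosing \<open>False\<close> is harmless.\<close>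

fun vpotential :: "code set \<Rightarrow> (code \<Rightarrow> real) \<Rightarrow> vert \<Rightarrow> real" where
  "vpotential E G (R n) = (if n = 0 then 0 else if n = 1 then fst (potential E G 0 []) else snd (potential E G 0 []))"
| "vpotential E G (N i bs) = snd (potential E G i (False # bs))"

text \<open>The values computed edge by edge agree at shared vertices and thus glue to one function
  on vertices.\<close>

lemma vpotential_base:
  "(vpotential E G (fst (base i bs)), vpotential E G (snd (base i bs))) = potential E G i bs"
proof (induction bs)
  case Nil
  then show ?case by (auto simp: Let_def)
next
  case (Cons b bs)
  then have "vpotential E G (fst (base i bs)) = fst (potential E G i bs)"
    "vpotential E G (snd (base i bs)) = snd (potential E G i bs)" by (metis fst_conv snd_conv)+
  then show ?case by auto
qed

text \<open>By \<open>fill\<close>, two sides of a triangle bring in the whole triangle.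
  \<open>potential\<close> uses only one of the two edges at a new vertex; if the other is present
  too, the triangle is there and closedness makes both prescriptions agree.\<close>

locale finite_subcomplex = subcomplex +
  assumes finite_X: "finite X"
    and fill: "t \<in> tcodes \<Longrightarrow> c \<in> sides t \<Longrightarrow> c' \<in> sides t \<Longrightarrow> c \<noteq> c' \<Longrightarrow>
      c \<in> ecodes X \<Longrightarrow> c' \<in> ecodes X \<Longrightarrow> t \<in> fcodes X"
begin

lemma finite_ecodes: "finite (ecodes X)"
proof (rule finite_imageD[OF _ inj_edge])
  show "finite (edge ` ecodes X)" by (rule finite_subset[OF _ finite_X]) (auto simp: ecodes_def)
qed

lemma finite_verts: "finite (verts X)"
proof (rule finite_imageD)
  show "finite ((\<lambda>v. {v}) ` verts X)" by (rule finite_subset[OF _ finite_X]) (auto simp: verts_def)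
qed simp

lemma finite_fcodes: "finite (fcodes X)"
proof (rule finite_subset)
  show "fcodes X \<subseteq> up ` ecodes X \<union> Some ` ecodes X"
  proof
    fix t assume t: "t \<in> fcodes X"
    have "sides t \<noteq> {}" using card_sides[of t] by auto
    then obtain c where c: "c \<in> sides t" by blast
    then have "c \<in> ecodes X" using sides_ecodes t by blast
    then show "t \<in> up ` ecodes X \<union> Some ` ecodes X" using c in_sides_iff[of c t] ecodes_codes by blast
  qed
qed (simp add: finite_ecodes)

section \<open>Summation by parts and the Hardy inequality\<close>

lemma curl_adjoint:
  "(\<Sum>c\<in>ecodes X. a c * bdry X h c) = (\<Sum>t\<in>fcodes X. h t * curl a t)"
proof -
  have "(\<Sum>c\<in>ecodes X. a c * bdry X h c) = (\<Sum>c\<in>ecodes X. \<Sum>t\<in>{t\<in>fcodes X. c \<in> sides t}. a c * (inc t c * h t))"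
    by (simp add: bdry_def cofaces_def sum_distrib_left)
  also have "\<dots> = (\<Sum>t\<in>fcodes X. \<Sum>c\<in>{c\<in>ecodes X. c \<in> sides t}. a c * (inc t c * h t))"
    by (rule sum.swap_restrict[OF finite_ecodes finite_fcodes])
  also have "\<dots> = (\<Sum>t\<in>fcodes X. h t * curl a t)"
  proof (rule sum.cong)
    fix t assume "t \<in> fcodes X"
    then have "{c\<in>ecodes X. c \<in> sides t} = sides t" using sides_ecodes by blast
    then show "(\<Sum>c\<in>{c\<in>ecodes X. c \<in> sides t}. a c * (inc t c * h t)) = h t * curl a t"
      by (simp add: curl_def sum_distrib_left mult_ac)
  qed simp
  finally show ?thesis .
qed

text \<open>The share of the energy of one edge given to its parent triangle \<open>up c\<close> and
  its child triangle \<open>Some c\<close>. A triangle collects the first coefficient from its two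
  lower edges and the second from its upper edge:
  \<open>2 * (1 - sqrt 2 / 2)/2 + (1 - sqrt 2)/2 = 3/2 - sqrt 2\<close>.\<close>

lemma hardy_edge:
  assumes "c \<in> ecodes X"
  shows "(bdry X h c)\<^sup>2 / cdeg X c \<ge> 
    (1 - sqrt 2 / 2) / 2 * (if up c \<in> fcodes X then (h (up c))\<^sup>2 else 0) +
    (1 - sqrt 2) / 2 * (if Some c \<in> fcodes X then (h (Some c))\<^sup>2 else 0)"
proof -
  have c: "c \<in> codes" using assms ecodes_codes by simp
  have sg: "sg c = 1 \<or> sg c = -1" by (cases c rule: code_cases) auto
  have s2: "sqrt 2 \<ge> 1" "sqrt 2 * sqrt 2 = 2" by simp_all
  define u v where "u = h (up c)" and "v = h (Some c)"
  \<comment> \<open>For boundary edges: there the degree is 1 and the full square is available, so a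
    coefficient at most 1 suffices.\<close>
  have nn: "(1 - sqrt 2 / 2) / 2 * u\<^sup>2 \<le> u\<^sup>2" "(1 - sqrt 2) / 2 * v\<^sup>2 \<le> v\<^sup>2"
    using mult_right_mono[of "(1 - sqrt 2 / 2) / 2" 1 "u\<^sup>2"] mult_right_mono[of "(1 - sqrt 2) / 2" 1 "v\<^sup>2"] s2
    by auto
  have b: "(1 - sqrt 2 / 2) / 2 * u\<^sup>2 + (1 - sqrt 2) / 2 * v\<^sup>2 \<le> (s * u + v)\<^sup>2 / 2" if s: "s = 1 \<or> s = -1" for s :: real
  proof -
    \<comment> \<open>The weight \<open>sqrt 2\<close> balances the cross term: it splits into
      \<open>sqrt 2 / 2\<close> times the parent square and \<open>sqrt 2\<close> times the child
      square.\<close>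
    have "0 \<le> sqrt 2 * (s * u / sqrt 2 + v)\<^sup>2" by simp
    also have "\<dots> = sqrt 2 / 2 * (s * s) * u\<^sup>2 + 2 * s * u * v + sqrt 2 * v\<^sup>2"
      using s2 by (simp add: power2_eq_square field_simps)
    also have "s * s = 1" using s by auto
    finally show ?thesis using s by (auto simp: power2_eq_square field_simps)
  qed
  have cf: "cofaces X c = (if up c \<in> fcodes X then {up c} else {}) \<union> (if Some c \<in> fcodes X then {Some c} else {})"
    using cofaces_eq[OF c] by auto
  show ?thesis
  proof (cases "up c \<in> fcodes X"; cases "Some c \<in> fcodes X")
    assume h: "up c \<in> fcodes X" "Some c \<in> fcodes X"
    then have "bdry X h c = sg c * u + v" "cdeg X c = 2"
      by (simp_all add: bdry_def cdeg_def cf inc_def u_def v_def)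
    then show ?thesis using b[OF sg] h by (simp add: u_def v_def)
  next
    assume h: "up c \<in> fcodes X" "Some c \<notin> fcodes X"
    then have "bdry X h c = sg c * u" "cdeg X c = 1"
      by (simp_all add: bdry_def cdeg_def cf inc_def u_def v_def)
    then show ?thesis using nn sg h by (auto simp: u_def v_def)
  next
    assume h: "up c \<notin> fcodes X" "Some c \<in> fcodes X"
    then have "bdry X h c = v" "cdeg X c = 1"
      by (simp_all add: bdry_def cdeg_def cf inc_def u_def v_def)
    then show ?thesis using nn sg h by (auto simp: u_def v_def)
  qed (simp add: cdeg_def)
qed

text \<open>Hardy inequality on the dual tree: on an edge between a parent \<open>p\<close> and a child \<open>q\<close> use
  \<open>2 h(p) h(q) \<le> h(p)^2 / sqrt 2 + sqrt 2 h(q)^2\<close>; every triangle has at least two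
  children and at most one parent.\<close>
lemma hardy: 
  "(\<Sum>c\<in>ecodes X. (bdry X h c)\<^sup>2 / cdeg X c) \<ge> (3/2 - sqrt 2) * (\<Sum>t\<in>fcodes X. (h t)\<^sup>2)"
proof -
  have s2: "sqrt 2 \<ge> 1" "sqrt 2 \<le> 2" by (simp_all add: real_le_lsqrt)
  \<comment> \<open>Regroups a sum over edges by triangles, used for \<open>p = up\<close> and for
    \<open>p = Some\<close>.\<close>
  have U: "(\<Sum>c\<in>ecodes X. if p c \<in> fcodes X then (h (p c))\<^sup>2 else 0) =
    (\<Sum>t\<in>fcodes X. real (card {c\<in>ecodes X. p c = t}) * (h t)\<^sup>2)" for p
  proof -
    have "(\<Sum>c\<in>ecodes X. if p c \<in> fcodes X then (h (p c))\<^sup>2 else 0) =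
      (\<Sum>c\<in>ecodes X. \<Sum>t\<in>{t\<in>fcodes X. p c = t}. (h t)\<^sup>2)"
    proof (rule sum.cong)
      fix c
      have "{t\<in>fcodes X. p c = t} = (if p c \<in> fcodes X then {p c} else {})" by auto
      then show "(if p c \<in> fcodes X then (h (p c))\<^sup>2 else 0) = (\<Sum>t\<in>{t\<in>fcodes X. p c = t}. (h t)\<^sup>2)" by simp
    qed simp
    also have "\<dots> = (\<Sum>t\<in>fcodes X. \<Sum>c\<in>{c\<in>ecodes X. p c = t}. (h t)\<^sup>2)"
      by (rule sum.swap_restrict[OF finite_ecodes finite_fcodes])
    finally show ?thesis by simp
  qed
  have 1: "(\<Sum>c\<in>ecodes X. if up c \<in> fcodes X then (h (up c))\<^sup>2 else 0) \<ge> 2 * (\<Sum>t\<in>fcodes X. (h t)\<^sup>2)"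
    unfolding U sum_distrib_left
  proof (intro sum_mono mult_right_mono)
    fix t assume t: "t \<in> fcodes X"
    have "\<exists>c1 c2. c1 \<noteq> c2 \<and> c1 \<in> sides t \<and> c2 \<in> sides t \<and> up c1 = t \<and> up c2 = t"
    proof (cases t)
      case None then show ?thesis by (intro exI[of _ "(0,[])"] exI[of _ "(1,[])"]) auto
    next
      case (Some c) then show ?thesis by (intro exI[of _ "child False c"] exI[of _ "child True c"]) auto
    qed
    then obtain c1 c2 where c: "c1 \<noteq> c2" "{c1,c2} \<subseteq> {c\<in>ecodes X. up c = t}" using sides_ecodes[OF t] by blast
    then have "card {c1,c2} \<le> card {c\<in>ecodes X. up c = t}" using finite_ecodes by (intro card_mono) auto
    then show "2 \<le> real (card {c\<in>ecodes X. up c = t})" using c by simp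
  qed simp
  have 2: "(\<Sum>c\<in>ecodes X. if Some c \<in> fcodes X then (h (Some c))\<^sup>2 else 0) \<le> 1 * (\<Sum>t\<in>fcodes X. (h t)\<^sup>2)"
    unfolding U sum_distrib_left
  proof (intro sum_mono mult_right_mono)
    fix t assume t: "t \<in> fcodes X"
    have "card {c\<in>ecodes X. Some c = t} \<le> card {the t}" by (intro card_mono) auto
    then show "real (card {c\<in>ecodes X. Some c = t}) \<le> 1" by simp
  qed simp
  have "(3/2 - sqrt 2) * (\<Sum>t\<in>fcodes X. (h t)\<^sup>2) = 
     (1 - sqrt 2 / 2) / 2 * (2 * (\<Sum>t\<in>fcodes X. (h t)\<^sup>2)) + (1 - sqrt 2) / 2 * (1 * (\<Sum>t\<in>fcodes X. (h t)\<^sup>2))"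
    by (simp add: field_simps)
  \<comment> \<open>The parent coefficient is positive and the child coefficient negative, so a
    lower bound on the first count and an upper bound on the second are what is needed.\<close>
  also have "\<dots> \<le> (1 - sqrt 2 / 2) / 2 * (\<Sum>c\<in>ecodes X. if up c \<in> fcodes X then (h (up c))\<^sup>2 else 0) +
     (1 - sqrt 2) / 2 * (\<Sum>c\<in>ecodes X. if Some c \<in> fcodes X then (h (Some c))\<^sup>2 else 0)"
    using 1 2 s2 by (intro add_mono mult_left_mono mult_left_mono_neg) auto
  also have "\<dots> = (\<Sum>c\<in>ecodes X. (1 - sqrt 2 / 2) / 2 * (if up c \<in> fcodes X then (h (up c))\<^sup>2 else 0) +
     (1 - sqrt 2) / 2 * (if Some c \<in> fcodes X then (h (Some c))\<^sup>2 else 0))"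
    by (simp only: sum.distrib sum_distrib_left)
  also have "\<dots> \<le> (\<Sum>c\<in>ecodes X. (bdry X h c)\<^sup>2 / cdeg X c)"
    by (intro sum_mono hardy_edge)
  finally show ?thesis .
qed

section \<open>\<open>Z1\<close> of a finite complex and its spectrum\<close>

lemma Omega1_L2_eq: "Omega1_L2 X = Omega1 X"
  using L2_codes finite_ecodes by (auto intro: summable_on_finite)

lemma inner1_finite:
  assumes "f \<in> Omega1 X" "g \<in> Omega1 X"
  shows "inner1 X f g = (\<Sum>c\<in>ecodes X. f (ed c) * g (ed c) / cdeg X c)"
  by (simp add: inner1_codes[OF assms] finite_ecodes)

lemma delta1_Omega1: "delta1 X \<phi> \<in> Omega1 X"
proof (rule Omega1I)
  fix u v
  show "delta1 X \<phi> (v,u) = - delta1 X \<phi> (u,v)"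
    using oedges_commute[of u v X] edeg_commute[of X u v] by (simp add: delta1_def algebra_simps)
qed (simp add: delta1_def)

lemma delta1_ed: "c \<in> ecodes X \<Longrightarrow> delta1 X \<phi> (ed c) = cdeg X c * (\<phi> (snd (ed c)) - \<phi> (fst (ed c)))"
  using ed_oedges edeg_ed[OF sub] ecodes_codes by (simp add: delta1_def)

text \<open>The degree in \<open>delta1\<close> cancels the weight of the inner product; then
  boundaries are orthogonal to gradients because \<open>curl\<close> is adjoint to
  \<open>bdry\<close> and kills gradients.\<close>

lemma bdry_Z1:
  assumes f: "f \<in> Omega1 X" and e: "\<And>c. c \<in> ecodes X \<Longrightarrow> f (ed c) = bdry X h c"
  shows "f \<in> Z1 X"
proof -
  have "inner1 X f g = 0" if gB: "g \<in> B1 X" for g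
  proof -
    obtain \<phi> where g: "g = delta1 X \<phi>" using gB by (auto simp: B1_def)
    have "inner1 X f g = (\<Sum>c\<in>ecodes X. f (ed c) * g (ed c) / cdeg X c)"
      using inner1_finite[OF f] delta1_Omega1 g by simp
    also have "\<dots> = (\<Sum>c\<in>ecodes X. (\<phi> (snd (ed c)) - \<phi> (fst (ed c))) * bdry X h c)"
    proof (rule sum.cong)
      fix c assume c: "c \<in> ecodes X"
      show "f (ed c) * g (ed c) / cdeg X c = (\<phi> (snd (ed c)) - \<phi> (fst (ed c))) * bdry X h c"
        using cdeg_pos[OF c] by (simp add: e[OF c] g delta1_ed[OF c])
    qed simp
    also have "\<dots> = (\<Sum>t\<in>fcodes X. h t * curl (\<lambda>c. \<phi> (snd (ed c)) - \<phi> (fst (ed c))) t)"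
      by (rule curl_adjoint)
    finally show ?thesis by (simp add: curl_grad)
  qed
  then show ?thesis using f by (simp add: Z1_def Omega1_L2_eq)
qed

text \<open>Most edges satisfy the claim by construction of \<open>potential\<close>. The exception
  is an edge whose new end was already reached along its twin edge; there \<open>fill\<close>
  supplies the triangle and closedness the equation.\<close>

lemma closed_imp_exact:
  assumes closed: "\<And>t. t \<in> fcodes X \<Longrightarrow> curl G t = 0" and c: "c \<in> ecodes X"
  defines "\<phi> \<equiv> vpotential (ecodes X) G"
  shows "G c = \<phi> (snd (ed c)) - \<phi> (fst (ed c))"
proof -
  let ?E = "ecodes X"
  let ?P = "potential ?E G"
  have "G (i,bs) = snd (?P i bs) - fst (?P i bs)" if "(i,bs) \<in> ?E" for i bs
    using that
  proof (induction bs)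
    case Nil
    then have i: "i = 0 \<or> i = 1 \<or> i = 2" using ecodes_codes Nil_in_codes by blast
    have "G (0,[]) - G (1,[]) + G (2,[]) = 0" "(2,[]) \<in> ?E" if "(0,[]) \<in> ?E" "(1,[]) \<in> ?E"
    proof -
      have "None \<in> fcodes X" using fill[of None "(0,[])" "(1,[])"] that by simp
      then show "G (0,[]) - G (1,[]) + G (2,[]) = 0" "(2,[]) \<in> ?E"
        using closed[of None] sides_ecodes[of None "(2,[])"] by (simp_all add: curl_simps)
    qed
    then show ?case using i Nil by (auto simp: Let_def)
  next
    case (Cons b bs)
    let ?c = "(i,bs)"
    have cc: "?c \<in> codes" using Cons.prems ecodes_codes by (force simp: codes_def)
    have 1: "G ?c + G (i, True # bs) - G (i, False # bs) = 0" "?c \<in> ?E"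
      if "(i, True # bs) \<in> ?E" "(i, False # bs) \<in> ?E"
    proof -
      have "Some ?c \<in> fcodes X" using fill[of "Some ?c" "child True ?c" "child False ?c"] that cc
        by (simp add: child_def)
      then show "G ?c + G (i, True # bs) - G (i, False # bs) = 0" "?c \<in> ?E"
        using closed[of "Some ?c"] sides_ecodes[of "Some ?c" ?c] by (simp_all add: curl_simps child_def)
    qed
    then show ?case using Cons by (cases b) auto
  qed
  moreover obtain i bs where "c = (i,bs)" by (cases c)
  moreover have "\<phi> (snd (ed (i,bs))) = snd (?P i bs)" "\<phi> (fst (ed (i,bs))) = fst (?P i bs)"
    using vpotential_base[of ?E G i bs] unfolding \<phi>_def ed_def by (metis fst_conv snd_conv)+
  ultimately show ?thesis using c by simp
qed

text \<open>If \<open>f / deg\<close> is closed then it is a gradient, so \<open>f\<close> lies in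
  \<open>B1 X\<close> and is orthogonal to itself.\<close>

lemma Z1_closed_zero:
  assumes f: "f \<in> Z1 X" and closed: "\<And>t. t \<in> fcodes X \<Longrightarrow> curl (\<lambda>c. f (ed c) / cdeg X c) t = 0"
  shows "f = (\<lambda>p. 0)"
proof -
  have fO: "f \<in> Omega1 X" using f by (simp add: Z1_def Omega1_L2_eq)
  define \<phi> where "\<phi> v = (if v \<in> verts X then vpotential (ecodes X) (\<lambda>c. f (ed c) / cdeg X c) v else 0)" for v
  have vx: "fst (ed c) \<in> verts X \<and> snd (ed c) \<in> verts X" if "c \<in> ecodes X" for c
    using that down[of "edge c"] by (auto simp: verts_def ecodes_def edge_def)
  have "f = delta1 X \<phi>"
  proof (rule Omega1_eqI[OF fO delta1_Omega1])
    fix c assume c: "c \<in> ecodes X"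
    have "f (ed c) / cdeg X c = \<phi> (snd (ed c)) - \<phi> (fst (ed c))"
      using closed_imp_exact[OF closed c] vx[OF c] by (simp add: \<phi>_def)
    then have "f (ed c) = cdeg X c * (\<phi> (snd (ed c)) - \<phi> (fst (ed c)))"
      using cdeg_pos[OF c] by (simp add: divide_eq_eq mult.commute)
    then show "f (ed c) = delta1 X \<phi> (ed c)" by (simp only: delta1_ed[OF c])
  qed
  moreover have "\<phi> \<in> Omega0_L2 X" using finite_verts by (simp add: Omega0_L2_def Omega0_def \<phi>_def summable_on_finite)
  ultimately have "f \<in> B1 X" using fO Omega1_L2_eq by (auto simp: B1_def)
  then have "inner1 X f f = 0" using f by (simp add: Z1_def)
  then have "(\<Sum>c\<in>ecodes X. f (ed c) * f (ed c) / cdeg X c) = 0" using inner1_finite[OF fO fO] by simp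
  then have "f (ed c) * f (ed c) / cdeg X c = 0" if "c \<in> ecodes X" for c
    using that finite_ecodes by (subst (asm) sum_nonneg_eq_0_iff) (auto simp: cdeg_def)
  then have "f (ed c) = 0" if "c \<in> ecodes X" for c using that cdeg_pos[OF that] by fastforce
  then show ?thesis by (intro Omega1_eqI[OF fO Omega1_zero]) auto
qed

text \<open>Here \<open>bdry h = \<mu> f\<close>, so by adjointness the weighted norm of
  \<open>bdry h\<close>, squared, is \<open>\<mu>\<close> times that of \<open>h\<close>. Comparison
  with \<open>hardy\<close> forces \<open>h = 0\<close>, that is, \<open>f / deg\<close> is
  closed.\<close>

lemma eigen_below_zero:
  assumes f: "f \<in> Z1 X" and mu: "\<mu> < 3/2 - sqrt 2"
    and eq: "\<And>c. c \<in> ecodes X \<Longrightarrow> upper_lap X f (ed c) = \<mu> * f (ed c)"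
  shows "f = (\<lambda>p. 0)"
proof -
  have fO: "f \<in> Omega1 X" using f by (simp add: Z1_def Omega1_L2_eq)
  define g where "g = (\<lambda>c. f (ed c) / cdeg X c)"
  define h where "h = curl g"
  have cb: "bdry X h c = \<mu> * f (ed c)" if "c \<in> ecodes X" for c
    using upper_lap_ed[OF fO that] eq[OF that] by (simp add: h_def g_def)
  have "(3/2 - sqrt 2) * (\<Sum>t\<in>fcodes X. (h t)\<^sup>2) \<le> (\<Sum>c\<in>ecodes X. (bdry X h c)\<^sup>2 / cdeg X c)"
    by (rule hardy)
  also have "\<dots> = (\<Sum>c\<in>ecodes X. \<mu> * (g c * bdry X h c))"
    by (rule sum.cong) (auto simp: cb g_def power2_eq_square)
  also have "\<dots> = \<mu> * (\<Sum>t\<in>fcodes X. (h t)\<^sup>2)"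
    by (simp add: sum_distrib_left[symmetric] curl_adjoint h_def power2_eq_square)
  finally have "(3/2 - sqrt 2 - \<mu>) * (\<Sum>t\<in>fcodes X. (h t)\<^sup>2) \<le> 0" by (simp add: algebra_simps)
  then have "(\<Sum>t\<in>fcodes X. (h t)\<^sup>2) \<le> 0" using mu by (simp add: mult_le_0_iff)
  then have "(\<Sum>t\<in>fcodes X. (h t)\<^sup>2) = 0" using sum_nonneg[of "fcodes X" "\<lambda>t. (h t)\<^sup>2"] by fastforce
  then have "h t = 0" if "t \<in> fcodes X" for t using that finite_fcodes by (simp add: sum_nonneg_eq_0_iff)
  then show ?thesis using Z1_closed_zero[OF f] by (simp add: h_def g_def)
qed

lemma Z1_lincomb:
  assumes f: "f \<in> Z1 X" "g \<in> Z1 X" shows "(\<lambda>p. a * f p - b * g p) \<in> Z1 X"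
proof -
  have O: "f \<in> Omega1 X" "g \<in> Omega1 X" using f by (simp_all add: Z1_def Omega1_L2_eq)
  note O' = Omega1_diff[OF O, of a b]
  have "inner1 X (\<lambda>p. a * f p - b * g p) k = 0" if k: "k \<in> B1 X" for k
  proof -
    have kO: "k \<in> Omega1 X" using k by (auto simp: B1_def Omega1_L2_eq)
    have "inner1 X (\<lambda>p. a * f p - b * g p) k = a * inner1 X f k - b * inner1 X g k"
      unfolding inner1_finite[OF O' kO] inner1_finite[OF O(1) kO] inner1_finite[OF O(2) kO]
      by (simp add: sum_distrib_left sum_subtractf[symmetric] algebra_simps diff_divide_distrib)
    then show ?thesis using f k by (simp add: Z1_def)
  qed
  then show ?thesis using O' by (simp add: Z1_def Omega1_L2_eq)
qed

lemma upper_lap_Z1: "f \<in> Z1 X \<Longrightarrow> upper_lap X f \<in> Z1 X"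
  by (rule bdry_Z1[OF upper_lap_in upper_lap_ed]) (simp_all add: Z1_def Omega1_L2_eq)

text \<open>Injectivity is \<open>eigen_below_zero\<close>; surjectivity follows as
  \<open>Z1 X\<close> consists of functions supported on the finite set
  \<open>oedges X\<close>.\<close>

lemma bij_below:
  assumes mu: "\<mu> < 3/2 - sqrt 2"
  shows "bij_betw (\<lambda>f e. upper_lap X f e - \<mu> * f e) (Z1 X) (Z1 X)" (is "bij_betw ?D _ _")
proof (rule bij_betw_imageI)
  have sub': "?D ` Z1 X \<subseteq> Z1 X" using Z1_lincomb[OF upper_lap_Z1, of _ _ 1 \<mu>] by auto
  show inj: "inj_on ?D (Z1 X)"
  proof (rule inj_onI)
    fix f g assume f: "f \<in> Z1 X" "g \<in> Z1 X" and e: "?D f = ?D g"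
    define k where "k = (\<lambda>p. f p - g p)"
    have k: "k \<in> Z1 X" using Z1_lincomb[OF f, of 1 1] by (simp add: k_def)
    have "upper_lap X k p = \<mu> * k p" for p
      using fun_cong[OF e, of p] unfolding k_def upper_lap_diff by (simp add: algebra_simps)
    then have "k = (\<lambda>p. 0)" by (intro eigen_below_zero[OF k mu])
    then show "f = g" by (metis (no_types, lifting) eq_iff_diff_eq_0 ext k_def)
  qed
  have z: "(\<lambda>p. 0) \<in> Z1 X" by (auto simp: Z1_def Omega1_L2_eq Omega1_zero inner1_def)
  show "?D ` Z1 X = Z1 X"
  proof (rule finite_support_inj_imp_surj[OF _ _ _ _ z _ _ sub' inj])
    have "oedges X \<subseteq> ed ` ecodes X \<union> prod.swap ` ed ` ecodes X"
    proof
      fix p assume p: "p \<in> oedges X"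
      obtain u v where uv: "p = (u,v)" by (cases p)
      then obtain c where "c \<in> ecodes X" "(u,v) = ed c \<or> (v,u) = ed c" using oedges_pair p by blast
      then show "p \<in> ed ` ecodes X \<union> prod.swap ` ed ` ecodes X" unfolding uv
        by (metis UnCI image_eqI swap_simp)
    qed
    then show "finite (oedges X)" using finite_ecodes finite_subset by blast
    show "f p = 0" if "f \<in> Z1 X" "p \<notin> oedges X" for f p
      using that Omega1_outside[of f X p] by (simp add: Z1_def Omega1_L2_eq)
    show "?D (\<lambda>x. f x + g x) = (\<lambda>x. ?D f x + ?D g x)" for f g
      by (auto simp: upper_lap_def fun_eq_iff add_divide_distrib sum.distrib algebra_simps)
    show "?D (\<lambda>x. a * f x) = (\<lambda>x. a * ?D f x)" for a f
      by (auto simp: upper_lap_def fun_eq_iff sum_distrib_left algebra_simps)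
    show "(\<lambda>x. f x + g x) \<in> Z1 X" if "f \<in> Z1 X" "g \<in> Z1 X" for f g
      using Z1_lincomb[OF that, of 1 "-1"] by simp
    show "(\<lambda>x. a * f x) \<in> Z1 X" if "f \<in> Z1 X" for f a
      using Z1_lincomb[OF that that, of a 0] by simp
  qed
qed

lemma spec_lower: "\<mu> \<in> spec_Z1 X \<Longrightarrow> 3/2 - sqrt 2 \<le> \<mu>"
  using bij_below[of \<mu>] by (force simp: spec_Z1_def)

text \<open>Moves an eigenfunction from triangles to edges by \<open>f = bdry h\<close>, which lies
  in \<open>Z1 X\<close> automatically. That \<open>\<mu>\<close> and \<open>h t\<close> are nonzero
  ensures \<open>f\<close> is not zero.\<close>

lemma eigenvalue_in_spec:
  assumes eq: "\<And>t. t \<in> fcodes X \<Longrightarrow> curl (\<lambda>c. bdry X h c / cdeg X c) t = \<mu> * h t"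
    and t: "t \<in> fcodes X" "h t \<noteq> 0" and mu: "\<mu> \<noteq> 0"
  shows "\<mu> \<in> spec_Z1 X"
proof -
  define f where "f = form (bdry X h)"
  have fO: "f \<in> Omega1 X" by (simp add: f_def form_Omega1)
  have fe: "f (ed c) = bdry X h c" if "c \<in> ecodes X" for c using that by (simp add: f_def form_ed)
  have fZ: "f \<in> Z1 X" using bdry_Z1[OF fO fe] .
  have b: "curl (\<lambda>c. f (ed c) / cdeg X c) t = \<mu> * h t" if "t \<in> fcodes X" for t
    unfolding eq[OF that, symmetric] using sides_ecodes[OF that] fe by (intro curl_cong) simp
  have "upper_lap X f (ed c) = \<mu> * f (ed c)" if c: "c \<in> ecodes X" for c
  proof -
    have "upper_lap X f (ed c) = (\<Sum>t\<in>cofaces X c. inc t c * curl (\<lambda>c. f (ed c) / cdeg X c) t)"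
      using upper_lap_ed[OF fO c] by (simp add: bdry_def)
    also have "\<dots> = (\<Sum>t\<in>cofaces X c. \<mu> * (inc t c * h t))"
      by (rule sum.cong) (auto simp: b cofaces_def)
    finally show ?thesis by (simp add: fe[OF c] bdry_def sum_distrib_left)
  qed
  then have "(\<lambda>p. 1 * upper_lap X f p - \<mu> * f p) = (\<lambda>p. 0)"
    by (intro Omega1_eqI[OF Omega1_diff[OF upper_lap_in[OF fO] fO] Omega1_zero]) simp
  then have "(\<lambda>p. upper_lap X f p - \<mu> * f p) = (\<lambda>p. upper_lap X (\<lambda>p. 0) p - \<mu> * 0)"
    by (simp add: upper_lap_def fun_eq_iff)
  moreover have "f \<noteq> (\<lambda>p. 0)"
  proof
    assume "f = (\<lambda>p. 0)"
    then have "curl (\<lambda>c. f (ed c) / cdeg X c) t = 0" by (simp add: curl_def)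
    then show False using b[OF t(1)] t(2) mu by simp
  qed
  moreover have "(\<lambda>p. 0) \<in> Z1 X" by (auto simp: Z1_def Omega1_L2_eq Omega1_zero inner1_def)
  ultimately have "\<not> inj_on (\<lambda>f e. upper_lap X f e - \<mu> * f e) (Z1 X)"
    using inj_onD[of "\<lambda>f e. upper_lap X f e - \<mu> * f e" "Z1 X" f "\<lambda>p. 0"] fZ by auto
  then show ?thesis by (auto simp: spec_Z1_def bij_betw_def)
qed

end

section \<open>Balls\<close>

lemma ball_edges_0: "e0 \<in> cells X 1 \<Longrightarrow> ball_edges X e0 0 = {e0}"
  by (auto simp: ball_edges_def)

lemma ball_edges_mono: "r \<le> r' \<Longrightarrow> ball_edges X e0 r \<subseteq> ball_edges X e0 r'"
  unfolding ball_edges_def using order_trans by blast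

lemma ball_edges_Suc:
  "ball_edges X e0 (Suc r) = ball_edges X e0 r \<union> {e'. \<exists>e\<in>ball_edges X e0 r. eadj X e e'}" (is "?L = ?R")
proof (intro set_eqI iffI)
  fix e assume "e \<in> ?L"
  then obtain n p where n: "e \<in> cells X 1" "n \<le> Suc r" "p 0 = e0" "p n = e" "\<forall>i<n. eadj X (p i) (p (Suc i))"
    unfolding ball_edges_def by blast
  show "e \<in> ?R"
  proof (cases "n \<le> r")
    case True
    then show ?thesis using n unfolding ball_edges_def by blast
  next
    case False
    then have "n = Suc r" using n by simp
    then have a: "eadj X (p r) e" using n by auto
    moreover have "p r \<in> ball_edges X e0 r"
      unfolding ball_edges_def mem_Collect_eq
    proof (intro conjI exI[of _ r] exI[of _ p])
      show "p r \<in> cells X 1" using a by (simp add: eadj_def)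
    qed (use n \<open>n = Suc r\<close> in auto)
    ultimately show ?thesis by blast
  qed
next
  fix e' assume "e' \<in> ?R"
  then consider "e' \<in> ball_edges X e0 r" | e where "e \<in> ball_edges X e0 r" "eadj X e e'" by blast
  then show "e' \<in> ?L"
  proof cases
    case 1
    then show ?thesis using ball_edges_mono[of r "Suc r"] by auto
  next
    case 2
    then obtain n p where n: "n \<le> r" "p 0 = e0" "p n = e" "\<forall>i<n. eadj X (p i) (p (Suc i))"
      unfolding ball_edges_def by blast
    show ?thesis unfolding ball_edges_def mem_Collect_eq
    proof (intro conjI exI[of _ "Suc n"] exI[of _ "p(Suc n := e')"])
      show "e' \<in> cells X 1" using 2 by (simp add: eadj_def)
      show "\<forall>i<Suc n. eadj X ((p(Suc n := e')) i) ((p(Suc n := e')) (Suc i))"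
        using n 2 by (auto simp: less_Suc_eq)
    qed (use n in auto)
  qed
qed

lemma cells_1_iff: "s \<in> cells X 1 \<longleftrightarrow> s \<in> X \<and> card s = 2"
  unfolding cells_def using card.infinite by fastforce

lemma cells_2_iff: "s \<in> cells X 2 \<longleftrightarrow> s \<in> X \<and> card s = 3"
  unfolding cells_def using card.infinite by fastforce

lemma finite_card_pos: "card s = Suc n \<Longrightarrow> finite s"
  using card.infinite by fastforce

lemma ball_edges_cells: "e \<in> ball_edges X e0 r \<Longrightarrow> e \<in> cells X 1"
  by (simp add: ball_edges_def)

lemma card_ball_edges: "e \<in> ball_edges X e0 r \<Longrightarrow> card e = 2"
  using ball_edges_cells cells_1_iff by blast

lemma card2_union:
  assumes "card e = 2" "card e' = 2" "e \<noteq> e'" "e \<subseteq> t" "e' \<subseteq> t" "card t = 3"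
  shows "e \<union> e' = t"
proof -
  have f: "finite t" "finite e" "finite e'" using assms finite_card_pos[of t 2] finite_subset by auto
  have "\<not> e' \<subseteq> e" using assms f card_subset_eq[of e e'] by auto
  then have "e \<subset> e \<union> e'" by auto
  then have "card e < card (e \<union> e')" using f by (intro psubset_card_mono) auto
  then have "card t \<le> card (e \<union> e')" using assms by simp
  then show ?thesis using f assms card_seteq[of t "e \<union> e'"] by simp
qed

text \<open>One step through a triangle reaches all its edges. Hence the triangles used by a path of
  length at most \<open>r\<close> from the centre lie in the ball of radius \<open>r\<close>, and
  distances up to \<open>r\<close> can be measured inside it.\<close>

lemma triangle_edges_in_ball:
  assumes "e \<in> ball_edges X e0 r" "eadj X e e'" "e'' \<in> cells X 1" "e'' \<subseteq> e \<union> e'"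
  shows "e'' \<in> ball_edges X e0 (Suc r)"
proof (cases "e'' = e")
  case True
  then show ?thesis using assms ball_edges_mono[of r "Suc r" X e0] by auto
next
  case False
  have "card e = 2" "card e'' = 2" "e \<union> e' \<in> cells X 2" "card (e \<union> e') = 3"
    using assms by (simp_all only: eadj_def cells_1_iff cells_2_iff)
  then have "e \<union> e'' = e \<union> e'" using False assms card2_union[of e e'' "e \<union> e'"] by auto
  then have "eadj X e e''" using assms by (simp add: eadj_def)
  then show ?thesis using assms(1) by (auto simp: ball_edges_Suc)
qed

lemma cells_ball_1:
  assumes "\<forall>s\<in>X. Pow s \<subseteq> X"
  shows "cells (ball X e0 r) 1 = ball_edges X e0 r"
proof (intro set_eqI iffI)
  fix s assume s: "s \<in> cells (ball X e0 r) 1"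
  then have c: "card s = 2" "s \<in> ball X e0 r" by (simp_all only: cells_1_iff)
  then consider e where "e \<in> ball_edges X e0 r" "s \<subseteq> e" 
    | t where "t \<in> cells X 2" "\<forall>e\<in>cells X 1. e \<subseteq> t \<longrightarrow> e \<in> ball_edges X e0 r" "s \<subseteq> t"
    unfolding ball_def by blast
  then show "s \<in> ball_edges X e0 r"
  proof cases
    case 1
    then have "card e = 2" using card_ball_edges by blast
    then have "s = e" using 1 c finite_card_pos[of e 1] card_subset_eq[of e s] by simp
    then show ?thesis using 1 by simp
  next
    case 2
    then have "s \<in> X" using assms unfolding cells_2_iff by blast
    then have "s \<in> cells X 1" using c by (simp only: cells_1_iff)
    then show ?thesis using 2 by blast
  qed
next
  fix s assume "s \<in> ball_edges X e0 r"
  moreover from this have "card s = 2" using card_ball_edges by blast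
  ultimately show "s \<in> cells (ball X e0 r) 1" unfolding cells_1_iff ball_def by blast
qed

lemma cells_ball_2:
  "cells (ball X e0 r) 2 = {t \<in> cells X 2. \<forall>e\<in>cells X 1. e \<subseteq> t \<longrightarrow> e \<in> ball_edges X e0 r}"
proof (intro set_eqI iffI)
  fix s assume s: "s \<in> cells (ball X e0 r) 2"
  then have c: "card s = 3" "s \<in> ball X e0 r" by (simp_all only: cells_2_iff)
  then consider e where "e \<in> ball_edges X e0 r" "s \<subseteq> e" 
    | t where "t \<in> cells X 2" "\<forall>e\<in>cells X 1. e \<subseteq> t \<longrightarrow> e \<in> ball_edges X e0 r" "s \<subseteq> t"
    unfolding ball_def by blast
  then show "s \<in> {t \<in> cells X 2. \<forall>e\<in>cells X 1. e \<subseteq> t \<longrightarrow> e \<in> ball_edges X e0 r}"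
  proof cases
    case 1
    then have "card e = 2" using card_ball_edges by blast
    then show ?thesis using 1 c finite_card_pos[of e 1] card_mono[of e s] by simp
  next
    case 2
    then have "card t = 3" by (simp only: cells_2_iff)
    then have "s = t" using 2 c finite_card_pos[of t 2] card_subset_eq[of t s] by simp
    then show ?thesis using 2 by simp
  qed
next
  fix t assume t: "t \<in> {t \<in> cells X 2. \<forall>e\<in>cells X 1. e \<subseteq> t \<longrightarrow> e \<in> ball_edges X e0 r}"
  then have "card t = 3" by (simp add: cells_2_iff)
  moreover have "t \<in> ball X e0 r"
    unfolding ball_def by (rule UnI2, rule CollectI, rule bexI[of _ t]) (use t in auto)
  ultimately show "t \<in> cells (ball X e0 r) 2" by (simp only: cells_2_iff)
qed

lemma ball_edges_ball:
  assumes down: "\<forall>s\<in>X. Pow s \<subseteq> X" and e0: "e0 \<in> cells X 1" and "k \<le> r"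
  shows "ball_edges (ball X e0 r) e0 k = ball_edges X e0 k"
  using \<open>k \<le> r\<close>
proof (induction k)
  case 0
  have "e0 \<in> ball_edges X e0 r" using ball_edges_mono[of 0 r X e0] e0 by (auto simp: ball_edges_0)
  then have "e0 \<in> cells (ball X e0 r) 1" by (simp only: cells_ball_1[OF down])
  then show ?case using e0 by (simp only: ball_edges_0)
next
  case (Suc k)
  have sub: "ball_edges X e0 (Suc k) \<subseteq> ball_edges X e0 r" using Suc.prems by (rule ball_edges_mono)
  have "eadj (ball X e0 r) e e' \<longleftrightarrow> eadj X e e'" if e: "e \<in> ball_edges X e0 k" for e e'
  proof
    assume "eadj (ball X e0 r) e e'"
    then show "eadj X e e'"
      using ball_edges_cells unfolding eadj_def cells_ball_1[OF down] cells_ball_2 by blast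
  next
    assume a: "eadj X e e'"
    then have cc: "e \<in> cells X 1" "e' \<in> cells X 1" "e \<union> e' \<in> cells X 2" by (simp_all add: eadj_def)
    have *: "e'' \<in> ball_edges X e0 r" if "e'' \<in> cells X 1" "e'' \<subseteq> e \<union> e'" for e''
      using triangle_edges_in_ball[OF e a that] sub by blast
    then show "eadj (ball X e0 r) e e'"
      using cc unfolding eadj_def cells_ball_1[OF down] cells_ball_2 by auto
  qed
  moreover have "ball_edges (ball X e0 r) e0 k = ball_edges X e0 k" using Suc by simp
  ultimately show ?case unfolding ball_edges_Suc by auto
qed

text \<open>This gives the convergence of marked complexes: the balls of radius \<open>k\<close>
  agree from \<open>r = k\<close> on.\<close>

lemma ball_ball:
  assumes down: "\<forall>s\<in>X. Pow s \<subseteq> X" and e0: "e0 \<in> cells X 1" and "k \<le> r"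
  shows "ball (ball X e0 r) e0 k = ball X e0 k"
proof -
  note b = ball_edges_ball[OF assms]
  have sub: "ball_edges X e0 k \<subseteq> ball_edges X e0 r" using assms(3) by (rule ball_edges_mono)
  have "t \<in> cells (ball X e0 r) 2 \<and> (\<forall>e\<in>cells (ball X e0 r) 1. e \<subseteq> t \<longrightarrow> e \<in> ball_edges X e0 k) \<longleftrightarrow>
    t \<in> cells X 2 \<and> (\<forall>e\<in>cells X 1. e \<subseteq> t \<longrightarrow> e \<in> ball_edges X e0 k)"
    (is "?A t \<longleftrightarrow> ?B t") for t
  proof
    assume A: "?A t"
    then have *: "t \<in> cells X 2" "\<forall>e\<in>cells X 1. e \<subseteq> t \<longrightarrow> e \<in> ball_edges X e0 r"
      by (simp_all add: cells_ball_2)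
    have **: "\<forall>e\<in>ball_edges X e0 r. e \<subseteq> t \<longrightarrow> e \<in> ball_edges X e0 k"
      using conjunct2[OF A] by (simp only: cells_ball_1[OF down])
    show "?B t"
    proof (intro conjI ballI impI)
      fix e assume "e \<in> cells X 1" "e \<subseteq> t"
      then show "e \<in> ball_edges X e0 k" using * ** by blast
    qed (rule *(1))
  next
    assume B: "?B t"
    then have "t \<in> cells (ball X e0 r) 2" using sub unfolding cells_ball_2 by blast
    moreover have "\<forall>e\<in>cells (ball X e0 r) 1. e \<subseteq> t \<longrightarrow> e \<in> ball_edges X e0 k"
      unfolding cells_ball_1[OF down] using conjunct2[OF B] ball_edges_cells by metis
    ultimately show "?A t" by (rule conjI)
  qed
  then show ?thesis unfolding ball_def[of "ball X e0 r"] ball_def[of X e0 k] b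
    by (simp only: Bex_def conj_assoc[symmetric])
qed

section \<open>Balls of the infinite complex in codes\<close>

fun code_ball :: "code \<Rightarrow> nat \<Rightarrow> code set" where
  "code_ball c0 0 = {c0}"
| "code_ball c0 (Suc r) = {c'. \<exists>c\<in>code_ball c0 r. \<exists>t\<in>tcodes. c \<in> sides t \<and> c' \<in> sides t}"

lemma code_ball_codes: "c0 \<in> codes \<Longrightarrow> code_ball c0 r \<subseteq> codes"
  by (cases r) (auto intro: sides_codes)

lemma code_ball_Suc_mono: "c0 \<in> codes \<Longrightarrow> code_ball c0 r \<subseteq> code_ball c0 (Suc r)"
proof
  fix c assume c: "c0 \<in> codes" "c \<in> code_ball c0 r"
  then have "c \<in> codes" using code_ball_codes by blast
  then have "up c \<in> tcodes" "c \<in> sides (up c)" using up_in_tcodes in_sides_iff by blast+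
  then show "c \<in> code_ball c0 (Suc r)" using c(2) by auto
qed

lemma code_ball_mono: assumes "c0 \<in> codes" "r \<le> r'" shows "code_ball c0 r \<subseteq> code_ball c0 r'"
  using assms(2) by (rule lift_Suc_mono_le[of "code_ball c0", OF code_ball_Suc_mono[OF assms(1)]])

lemma T22_down: "\<forall>s\<in>T22. Pow s \<subseteq> T22"
  using T.down by blast

lemma cells_T22_1: "cells T22 1 = edge ` codes"
  using T.cells_1 by (simp add: ecodes_T22)

lemma cells_T22_2: "cells T22 2 = face ` tcodes"
proof (intro set_eqI iffI)
  fix s assume "s \<in> cells T22 2" then show "s \<in> face ` tcodes" unfolding cells_2_iff using T22_triple by blast
next
  fix s assume "s \<in> face ` tcodes" then show "s \<in> cells T22 2" unfolding cells_2_iff using face_in_T22 by auto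
qed

lemma eadj_T22:
  assumes "c \<in> codes" "c' \<in> codes"
  shows "eadj T22 (edge c) (edge c') \<longleftrightarrow> c \<noteq> c' \<and> (\<exists>t\<in>tcodes. c \<in> sides t \<and> c' \<in> sides t)"
proof
  assume a: "eadj T22 (edge c) (edge c')"
  then obtain t where t: "t \<in> tcodes" "edge c \<union> edge c' = face t" unfolding eadj_def cells_T22_2 by blast
  have "c \<noteq> c'"
  proof
    assume "c = c'"
    then have "edge c = face t" using t by simp
    then show False using card_face[of t] card_edge[of c] by simp
  qed
  moreover have "edge c \<subseteq> face t" "edge c' \<subseteq> face t" using t by auto
  ultimately show "c \<noteq> c' \<and> (\<exists>t\<in>tcodes. c \<in> sides t \<and> c' \<in> sides t)"
    using t(1) edge_subset_face_iff assms by blast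
next
  assume "c \<noteq> c' \<and> (\<exists>t\<in>tcodes. c \<in> sides t \<and> c' \<in> sides t)"
  then obtain t where t: "c \<noteq> c'" "t \<in> tcodes" "c \<in> sides t" "c' \<in> sides t" by blast
  then have "edge c \<noteq> edge c'" using edge_inj assms by blast
  then have "edge c \<union> edge c' = face t"
    using t by (intro card2_union) (simp_all add: edge_subset_face)
  then show "eadj T22 (edge c) (edge c')" using t assms unfolding eadj_def cells_T22_1 cells_T22_2 by simp
qed

text \<open>A step of \<open>code_ball\<close> may stay at the same edge, which \<open>eadj\<close>
  forbids; the balls agree since they consist of edges at distance at most \<open>r\<close>.\<close>

lemma ball_edges_T22:
  assumes "c0 \<in> codes" shows "ball_edges T22 (edge c0) r = edge ` code_ball c0 r"
proof (induction r)
  case 0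
  then show ?case using assms ball_edges_0[of "edge c0" T22] unfolding cells_T22_1 by simp
next
  case (Suc r)
  show ?case
  proof (intro set_eqI iffI)
    fix e assume "e \<in> ball_edges T22 (edge c0) (Suc r)"
    then consider "e \<in> edge ` code_ball c0 r" | c where "c \<in> code_ball c0 r" "eadj T22 (edge c) e"
      unfolding ball_edges_Suc Suc by blast
    then show "e \<in> edge ` code_ball c0 (Suc r)"
    proof cases
      case 1 then show ?thesis using code_ball_Suc_mono[OF assms] by blast
    next
      case 2
      then have "e \<in> edge ` codes" using cells_T22_1 by (simp add: eadj_def)
      then obtain c' where c': "c' \<in> codes" "e = edge c'" by blast
      then have "c' \<in> code_ball c0 (Suc r)" using 2 eadj_T22[of c c'] code_ball_codes[OF assms] by auto
      then show ?thesis using c' by blast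
    qed
  next
    fix e assume "e \<in> edge ` code_ball c0 (Suc r)"
    then obtain c c' t where c: "c \<in> code_ball c0 r" "t \<in> tcodes" "c \<in> sides t" "c' \<in> sides t" "e = edge c'" by auto
    then have cc: "c \<in> codes" "c' \<in> codes" using sides_codes by blast+
    show "e \<in> ball_edges T22 (edge c0) (Suc r)"
    proof (cases "c = c'")
      case True
      then show ?thesis using c unfolding ball_edges_Suc Suc by blast
    next
      case False
      then have "eadj T22 (edge c) e" using eadj_T22[OF cc] c by blast
      then show ?thesis using c unfolding ball_edges_Suc Suc by blast
    qed
  qed
qed

text \<open>The edge \<open>c\<close> is \<open>d\<close> or lies below it. As the latest choice
  comes first in a code, ancestors are suffixes.\<close>

definition desc :: "code \<Rightarrow> code \<Rightarrow> bool" where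
  "desc d c \<longleftrightarrow> fst c = fst d \<and> (\<exists>cs. snd c = cs @ snd d)"

lemma desc_child: "desc d (child b c) \<longleftrightarrow> desc d c \<or> child b c = d"
  by (auto simp: desc_def child_def Cons_eq_append_conv prod_eq_iff)

lemma desc_Nil: "desc d (i, []) \<longleftrightarrow> d = (i, [])"
  by (auto simp: desc_def prod_eq_iff)

lemma desc_child_self: "\<not> desc (child b d) d"
  by (auto simp: desc_def child_def dest: arg_cong[of _ _ length])

text \<open>Labels the connected component containing \<open>c\<close> after the triangle \<open>t\<close> is removed.\<close>
fun component :: "code option \<Rightarrow> code \<Rightarrow> nat \<times> bool \<times> bool" where
  "component None c = (fst c, False, False)"
| "component (Some d) c = (0, desc (child False d) c, desc (child True d) c)"

text \<open>Removing \<open>t\<close> does not touch another triangle, so the sides of the latter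
  stay connected.\<close>

lemma component_const: "t' \<noteq> t \<Longrightarrow> c \<in> sides t' \<Longrightarrow> c' \<in> sides t' \<Longrightarrow> component t c = component t c'"
proof -
  assume t: "t' \<noteq> t" and c: "c \<in> sides t'" "c' \<in> sides t'"
  have "\<exists>k. \<forall>c\<in>sides t'. component t c = k"
  proof (cases t)
    case None
    then obtain d where "t' = Some d" using t by (cases t') auto
    then show ?thesis using None by (auto simp: child_def)
  next
    case (Some d)
    show ?thesis
    proof (cases t')
      case None
      then show ?thesis using Some by (auto simp: desc_Nil)
    next
      case (Some d')
      then show ?thesis using \<open>t = Some d\<close> t by (intro exI[of _ "component t d'"]) (auto simp: desc_child)
    qed
  qed
  then show ?thesis using c by metis
qed

lemma component_inj: "c \<in> sides t \<Longrightarrow> c' \<in> sides t \<Longrightarrow> component t c = component t c' \<Longrightarrow> c = c'"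
  by (cases t) (auto simp: desc_child desc_child_self)

text \<open>If \<open>t\<close> is not contained in the ball, no path inside the ball steps through
  \<open>t\<close>, so the ball stays in one component of the complement of \<open>t\<close>. Two
  different sides of \<open>t\<close> lie in different components.\<close>

lemma code_ball_fill:
  assumes "c0 \<in> codes" "t \<in> tcodes" "c \<in> sides t" "c' \<in> sides t" "c \<noteq> c'" "c \<in> code_ball c0 r" "c' \<in> code_ball c0 r"
  shows "sides t \<subseteq> code_ball c0 r"
proof (rule ccontr)
  assume n: "\<not> sides t \<subseteq> code_ball c0 r"
  have "component t c = component t c0" if "k \<le> r" "c \<in> code_ball c0 k" for k c
    using that
  proof (induction k arbitrary: c)
    case (Suc k)
    then obtain c1 t' where c1: "c1 \<in> code_ball c0 k" "t' \<in> tcodes" "c1 \<in> sides t'" "c \<in> sides t'" by auto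
    then have "sides t' \<subseteq> code_ball c0 (Suc k)" by auto
    then have "sides t' \<subseteq> code_ball c0 r" using code_ball_mono[OF assms(1) Suc.prems(1)] by blast
    then have "t' \<noteq> t" using n by blast
    then have "component t c = component t c1" using component_const c1 by blast
    then show ?case using Suc.IH[of c1] Suc.prems c1 by simp
  qed simp
  then have "component t c = component t c'" using assms by (metis order_refl)
  then show False using component_inj assms by blast
qed

lemma length_sides: "c \<in> sides t \<Longrightarrow> c' \<in> sides t \<Longrightarrow> length (snd c') \<le> Suc (length (snd c))"
  by (cases t) (auto simp: child_def)

lemma finite_code_ball: "c0 \<in> codes \<Longrightarrow> finite (code_ball c0 r)"
proof -
  assume c0: "c0 \<in> codes"
  have "length (snd c) \<le> length (snd c0) + r" if "c \<in> code_ball c0 r" for c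
    using that
  proof (induction r arbitrary: c)
    case (Suc r)
    then obtain c1 t where "c1 \<in> code_ball c0 r" "c1 \<in> sides t" "c \<in> sides t" by auto
    then show ?case using Suc.IH[of c1] length_sides[of c1 t c] by simp
  qed simp
  then have "code_ball c0 r \<subseteq> {..<3} \<times> {bs. length bs \<le> length (snd c0) + r}"
    using code_ball_codes[OF c0, of r] by (fastforce simp: codes_def)
  moreover have "finite {bs :: bool list. length bs \<le> length (snd c0) + r}"
    using finite_lists_length_le[of "UNIV :: bool set"] by simp
  ultimately show ?thesis by (meson finite_SigmaI finite_lessThan finite_subset)
qed

lemma ecodes_ball: 
  assumes "c0 \<in> codes" shows "ecodes (ball T22 (edge c0) r) = code_ball c0 r"
proof -
  have "edge c \<in> ball T22 (edge c0) r \<longleftrightarrow> edge c \<in> edge ` code_ball c0 r" for c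
    using trans[OF cells_ball_1[OF T22_down] ball_edges_T22[OF assms]]
      cells_1_iff[of "edge c" "ball T22 (edge c0) r"] by simp
  then show ?thesis using code_ball_codes[OF assms, of r] edge_inj unfolding ecodes_def by blast
qed

lemma fcodes_ball: 
  assumes "c0 \<in> codes" shows "fcodes (ball T22 (edge c0) r) = {t \<in> tcodes. sides t \<subseteq> code_ball c0 r}"
proof -
  have "face t \<in> ball T22 (edge c0) r \<longleftrightarrow> sides t \<subseteq> code_ball c0 r" if t: "t \<in> tcodes" for t
  proof -
    have "face t \<in> ball T22 (edge c0) r \<longleftrightarrow> face t \<in> cells (ball T22 (edge c0) r) 2"
      by (simp add: cells_2_iff)
    also have "\<dots> \<longleftrightarrow> (\<forall>c\<in>codes. edge c \<subseteq> face t \<longrightarrow> edge c \<in> edge ` code_ball c0 r)"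
      unfolding cells_ball_2 cells_T22_1 cells_T22_2 ball_edges_T22[OF assms] using t by auto
    also have "\<dots> \<longleftrightarrow> (\<forall>c\<in>codes. c \<in> sides t \<longrightarrow> c \<in> code_ball c0 r)"
      using edge_subset_face_iff[OF _ t] code_ball_codes[OF assms, of r] edge_inj by blast
    also have "\<dots> \<longleftrightarrow> sides t \<subseteq> code_ball c0 r" using sides_codes t by blast
    finally show ?thesis .
  qed
  then show ?thesis by (auto simp: fcodes_def)
qed

lemma finite_subcomplex_ball:
  assumes c0: "c0 \<in> codes" and r: "r \<ge> 1"
  shows "finite_subcomplex (ball T22 (edge c0) r)"
proof
  let ?X = "ball T22 (edge c0) r"
  note E = ecodes_ball[OF c0, of r] and F = fcodes_ball[OF c0, of r]
  show sub: "?X \<subseteq> T22"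
  proof
    fix s assume "s \<in> ?X"
    then have "(\<exists>c\<in>code_ball c0 r. s \<subseteq> edge c) \<or> (\<exists>t\<in>cells T22 2. s \<subseteq> t)"
      unfolding ball_def ball_edges_T22[OF c0] by blast
    then show "s \<in> T22"
      using T.down edge_in_T22 code_ball_codes[OF c0, of r] face_in_T22 unfolding cells_T22_2 by blast
  qed
  show dn: "s' \<in> ?X" if "s \<in> ?X" "s' \<subseteq> s" for s s'
    using that unfolding ball_def by blast
  show "cofaces ?X c \<noteq> {}" if c: "c \<in> ecodes ?X" for c
  proof -
    obtain k where k: "r = Suc k" using r by (cases r) auto
    then obtain c1 t where t: "c1 \<in> code_ball c0 k" "t \<in> tcodes" "c1 \<in> sides t" "c \<in> sides t"
      using c E by auto
    then have "sides t \<subseteq> code_ball c0 r" unfolding k by auto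
    then have "t \<in> cofaces ?X c" using t F by (simp add: cofaces_def)
    then show ?thesis by blast
  qed
  show "t \<in> fcodes ?X" if "t \<in> tcodes" "c \<in> sides t" "c' \<in> sides t" "c \<noteq> c'" "c \<in> ecodes ?X" "c' \<in> ecodes ?X" for t c c'
    using code_ball_fill[OF c0 that(1-4)] that unfolding E F by blast
  have "?X \<subseteq> Pow (\<Union> (edge ` code_ball c0 r))"
  proof
    fix s assume "s \<in> ?X"
    then consider e where "e \<in> edge ` code_ball c0 r" "s \<subseteq> e"
      | t where "t \<in> cells T22 2" "\<forall>e\<in>cells T22 1. e \<subseteq> t \<longrightarrow> e \<in> edge ` code_ball c0 r" "s \<subseteq> t"
      unfolding ball_def ball_edges_T22[OF c0] by blast
    then show "s \<in> Pow (\<Union> (edge ` code_ball c0 r))"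
    proof cases
      case 2
      then obtain u where u: "u \<in> tcodes" "t = face u" using cells_T22_2 by auto
      have "v \<in> \<Union> (edge ` sides u)" if "v \<in> face u" for v
        using that by (cases u) (auto simp: edge_def)
      moreover have "edge c \<in> edge ` code_ball c0 r" if "c \<in> sides u" for c
        using 2(2) edge_subset_face[OF that] sides_codes[OF u(1) that] unfolding u(2) cells_T22_1 by blast
      ultimately show ?thesis using 2(3) u(2) by blast
    qed blast
  qed
  then show "finite ?X" using finite_code_ball[OF c0] by (meson finite_Pow_iff finite_UN finite_edge finite_subset)
qed

section \<open>Radial eigenfunctions and the upper bound\<close>

definition below :: "code \<Rightarrow> bool list \<Rightarrow> code" where
  "below c0 cs = (fst c0, cs @ snd c0)"

lemma below_Cons: "below c0 (b # cs) = child b (below c0 cs)"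
  by (simp add: below_def child_def)

lemma below_Nil: "below c0 [] = c0"
  by (simp add: below_def)

lemma below_codes [simp]: "below c0 cs \<in> codes \<longleftrightarrow> c0 \<in> codes"
  by (simp add: below_def codes_def)

lemma desc_iff_below: "desc d c \<longleftrightarrow> (\<exists>cs. c = below d cs)"
  by (auto simp: desc_def below_def prod_eq_iff)

text \<open>Distance from \<open>c0\<close> for edges below it, and 0 elsewhere. It changes by at
  most 1 across a triangle, which bounds distances from below.\<close>

definition ldepth :: "code \<Rightarrow> code \<Rightarrow> nat" where
  "ldepth c0 c = (if desc c0 c then length (snd c) - length (snd c0) else 0)"

lemma ldepth_below [simp]: "ldepth c0 (below c0 cs) = length cs"
  by (auto simp: ldepth_def desc_def below_def)

lemma ldepth_sides: 
  assumes "c \<in> sides t" "c' \<in> sides t" shows "ldepth c0 c' \<le> Suc (ldepth c0 c)"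
proof (cases t)
  case None
  then show ?thesis using assms by (auto simp: ldepth_def)
next
  case (Some d)
  have "ldepth c0 (child b d) = (if desc c0 d then Suc (ldepth c0 d) else 0)" for b
  proof (cases "desc c0 d")
    case True
    then obtain cs where "d = below c0 cs" using desc_iff_below by blast
    then show ?thesis using True ldepth_below[of c0 "b # cs"] by (simp add: below_Cons)
  next
    case False
    then show ?thesis using desc_child[of c0 b d] by (auto simp: ldepth_def)
  qed
  then show ?thesis using assms Some by (cases "desc c0 d") (auto simp: ldepth_def[of c0 d])
qed

lemma below_code_ball: 
  assumes "c0 \<in> codes" shows "below c0 cs \<in> code_ball c0 r \<longleftrightarrow> length cs \<le> r"
proof
  have "ldepth c0 c \<le> r" if "c \<in> code_ball c0 r" for c
    using that
  proof (induction r arbitrary: c)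
    case 0
    then show ?case using ldepth_below[of c0 "[]"] by (simp add: below_Nil)
  next
    case (Suc r)
    then obtain c1 t where "c1 \<in> code_ball c0 r" "c1 \<in> sides t" "c \<in> sides t" by auto
    then show ?case using Suc.IH[of c1] ldepth_sides[of c1 t c c0] by simp
  qed
  then show "below c0 cs \<in> code_ball c0 r \<Longrightarrow> length cs \<le> r" by (metis ldepth_below)
next
  have "below c0 cs \<in> code_ball c0 (length cs)"
  proof (induction cs)
    case (Cons b cs)
    have "Some (below c0 cs) \<in> tcodes" using assms by simp
    moreover have "below c0 cs \<in> sides (Some (below c0 cs))" "below c0 (b # cs) \<in> sides (Some (below c0 cs))"
      by (auto simp: below_Cons)
    ultimately have "below c0 (b # cs) \<in> code_ball c0 (Suc (length cs))"
      unfolding code_ball.simps using Cons by blast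
    then show ?case by (simp only: list.size(4) add_Suc_right add_0_right)
  qed (simp add: below_Nil)
  then show "length cs \<le> r \<Longrightarrow> below c0 cs \<in> code_ball c0 r" using code_ball_mono[OF assms] by blast
qed

lemma below_fcodes:
  assumes "c0 \<in> codes" 
  shows "Some (below c0 cs) \<in> fcodes (ball T22 (edge c0) r) \<longleftrightarrow> length cs < r"
  using assms below_code_ball[OF assms, of cs r] below_code_ball[OF assms, of "True # cs" r]
    below_code_ball[OF assms, of "False # cs" r]
  by (auto simp: fcodes_ball below_Cons)

text \<open>For nonempty \<open>cs\<close> the sign of \<open>b # cs\<close> is minus the incidence
  \<open>sg\<close> times that of \<open>cs\<close>, so that \<open>bdry\<close> becomes a
  difference of radial values. Both one-letter lists get 1 although their edges have opposite
  incidence in the first triangle; this produces the antisymmetry.\<close>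

fun tsign :: "bool list \<Rightarrow> real" where
  "tsign [] = 1"
| "tsign (b # cs) = (if cs = [] then 1 else if b then - tsign cs else tsign cs)"

text \<open>The eigenfunction is radial below the central edge, up to the signs that make neighbouring triangles
  consistently oriented, and antisymmetric between the two branches of the first triangle
  below that edge, on which it vanishes.\<close>
definition radial :: "(nat \<Rightarrow> real) \<Rightarrow> code \<Rightarrow> code option \<Rightarrow> real" where
  "radial \<phi> c0 t = (case t of None \<Rightarrow> 0 | Some c \<Rightarrow>
     if desc c0 c then tsign (take (ldepth c0 c) (snd c)) * \<phi> (ldepth c0 c) else 0)"

lemma radial_below [simp]: "radial \<phi> c0 (Some (below c0 cs)) = tsign cs * \<phi> (length cs)"
  using desc_iff_below[of c0 "below c0 cs"] by (auto simp: radial_def) (simp add: below_def)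

context
  fixes c0 :: code and r :: nat and \<phi> :: "nat \<Rightarrow> real"
  assumes c0: "c0 \<in> codes" and r: "r \<ge> 2" and phi0: "\<phi> 0 = 0"
begin

text \<open>The function vanishes outside the subtree and, as \<open>\<phi> 0 = 0\<close>, also on
  the first triangle below \<open>c0\<close>; so even the edge \<open>c0\<close> itself sees only
  zeros.\<close>

lemma bdry_radial_outside:
  assumes "c \<in> codes" "\<not> desc c0 c \<or> c = c0"
  shows "bdry (ball T22 (edge c0) r) (radial \<phi> c0) c = 0"
proof -
  have 1: "radial \<phi> c0 (Some c) = 0"
    using assms(2) radial_below[of \<phi> c0 "[]"] phi0 by (auto simp: radial_def below_Nil split: option.splits)
  have 2: "radial \<phi> c0 (up c) = 0"
  proof (cases c rule: code_cases)
    case (Nil i)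
    then show ?thesis by (simp add: radial_def)
  next
    case (child b c')
    have "\<not> desc c0 c'"
    proof
      assume d: "desc c0 c'"
      then have "desc c0 c" using child desc_child by simp
      then have "c0 = child b c'" using assms child by simp
      then show False using d desc_child_self by simp
    qed
    then show ?thesis using child by (simp add: radial_def)
  qed
  have "inc t c * radial \<phi> c0 t = 0" if "t \<in> cofaces (ball T22 (edge c0) r) c" for t
    using that cofaces_subset[OF assms(1), of "ball T22 (edge c0) r"] 1 2 by auto
  then show ?thesis unfolding bdry_def by (rule sum.neutral[OF ballI])
qed

lemma bdry_radial_below:
  assumes "length cs < r"
  shows "bdry (ball T22 (edge c0) r) (radial \<phi> c0) (below c0 (b # cs)) / cdeg (ball T22 (edge c0) r) (below c0 (b # cs)) = 
    (if Suc (length cs) < r then tsign (b # cs) * (\<phi> (Suc (length cs)) - \<phi> (length cs)) / 2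
     else (if b then 1 else -1) * tsign cs * \<phi> (length cs))"
proof -
  let ?c = "below c0 (b # cs)"
  have c: "?c \<in> codes" using c0 by simp
  have up: "up ?c = Some (below c0 cs)" by (simp add: below_Cons)
  have ne: "below c0 cs \<noteq> ?c" by (simp add: below_Cons)
  have sg: "sg ?c = (if b then 1 else -1)" by (simp add: below_Cons)
  have upX: "up ?c \<in> fcodes (ball T22 (edge c0) r)" using below_fcodes[OF c0, of cs r] assms up by simp
  show ?thesis
  proof (cases "Suc (length cs) < r")
    case True
    then have "Some ?c \<in> fcodes (ball T22 (edge c0) r)" using below_fcodes[OF c0, of "b # cs" r] by simp
    then have cf: "cofaces (ball T22 (edge c0) r) ?c = {up ?c, Some ?c}" using cofaces_eq[OF c] upX by auto
    have "bdry (ball T22 (edge c0) r) (radial \<phi> c0) ?c = sg ?c * (tsign cs * \<phi> (length cs)) + tsign (b # cs) * \<phi> (Suc (length cs))"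
      unfolding bdry_def cf using radial_below[of \<phi> c0 "b # cs"] up ne
      by (simp add: inc_def del: tsign.simps)
    \<comment> \<open>For empty \<open>cs\<close> the signs may disagree, but then
      \<open>\<phi> 0 = 0\<close>.\<close>
    moreover have "sg ?c * (tsign cs * \<phi> (length cs)) = - tsign (b # cs) * \<phi> (length cs)"
      unfolding sg using phi0 by (cases cs) auto
    moreover have "cdeg (ball T22 (edge c0) r) ?c = 2" by (simp add: cdeg_def cf)
    ultimately show ?thesis using True by (simp add: algebra_simps del: tsign.simps)
  next
    case False
    then have "Some ?c \<notin> fcodes (ball T22 (edge c0) r)" using below_fcodes[OF c0, of "b # cs" r] by simp
    then have cf: "cofaces (ball T22 (edge c0) r) ?c = {up ?c}" using cofaces_eq[OF c] upX by auto
    have "bdry (ball T22 (edge c0) r) (radial \<phi> c0) ?c = sg ?c * (tsign cs * \<phi> (length cs))"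
      unfolding bdry_def cf using up ne by (simp add: inc_def)
    moreover have "cdeg (ball T22 (edge c0) r) ?c = 1" by (simp add: cdeg_def cf)
    ultimately show ?thesis using False sg by simp
  qed
qed

text \<open>In \<open>rec\<close> the parent has weight 1/2 and the two children, with equal values,
  weight 1 together; 3/2 is three edges of degree 2.\<close>

lemma radial_eigen:
  assumes rec: "\<And>k. 3/2 * \<phi> (Suc k) - \<phi> k / 2 - \<phi> (Suc (Suc k)) = \<mu> * \<phi> (Suc k)"
    and bnd: "\<phi> r = - \<phi> (r - 1)" and t: "t \<in> fcodes (ball T22 (edge c0) r)"
  shows "curl (\<lambda>c. bdry (ball T22 (edge c0) r) (radial \<phi> c0) c / cdeg (ball T22 (edge c0) r) c) t = \<mu> * radial \<phi> c0 t"
    (is "curl ?a t = _")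
proof -
  have out: "?a c = 0" if "c \<in> codes" "\<not> desc c0 c \<or> c = c0" for c
    using bdry_radial_outside[OF that] by simp
  have tc: "t \<in> tcodes" using t by (simp add: fcodes_def)
  show ?thesis
  proof (cases "\<exists>cs. t = Some (below c0 cs)")
    case True
    then obtain cs where cs: "t = Some (below c0 cs)" by blast
    then have l: "length cs < r" using t below_fcodes[OF c0] by simp
    have b: "curl ?a (Some (below c0 cs)) = ?a (below c0 cs) + ?a (below c0 (True # cs)) - ?a (below c0 (False # cs))"
      by (simp add: curl_simps below_Cons)
    note kids = bdry_radial_below[OF l]
    show ?thesis
    proof (cases cs)
      case Nil
      \<comment> \<open>The two lower edges of the first triangle carry equal values and enter its
        circulation with opposite signs.\<close>
      have "?a (below c0 cs) = 0" using out[of c0] c0 by (simp add: Nil below_Nil)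
      then show ?thesis unfolding cs b kids using r Nil phi0 by simp
    next
      case (Cons b' cs')
      have a: "?a (below c0 cs) = tsign cs * (\<phi> (length cs) - \<phi> (length cs')) / 2"
        unfolding Cons using bdry_radial_below[of cs' b'] l Cons by (simp del: tsign.simps)
      have g: "tsign (True # cs) = - tsign cs" "tsign (False # cs) = tsign cs" using Cons by simp_all
      have k: "length cs = Suc (length cs')" using Cons by simp
      have rec': "\<mu> * (tsign cs * \<phi> (length cs)) = tsign cs * (3/2 * \<phi> (length cs) - \<phi> (length cs') / 2 - \<phi> (Suc (length cs)))"
        using rec[of "length cs'"] k by simp
      show ?thesis
      proof (cases "Suc (length cs) < r")
        case True
        then show ?thesis unfolding cs b kids a g radial_below rec' by (simp add: field_simps)
      next
        case False
        then have "r = Suc (length cs)" using l by simp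
        \<comment> \<open>With the ghost value \<open>- \<phi> (r - 1)\<close> at depth
          \<open>r\<close>, the formula for edges of degree 2 gives the correct value on edges of
          degree 1.\<close>
        then have "\<phi> (Suc (length cs)) = - \<phi> (length cs)" using bnd by simp
        then show ?thesis using False unfolding cs b kids a g radial_below rec' by (simp add: field_simps)
      qed
    qed
  next
    case False
    then have "radial \<phi> c0 t = 0" by (auto simp: radial_def desc_iff_below split: option.splits)
    moreover have az: "?a c = 0" if c: "c \<in> sides t" for c
    proof (rule out)
      show "c \<in> codes" using sides_codes[OF tc c] .
      show "\<not> desc c0 c \<or> c = c0"
      proof (cases t)
        case None then show ?thesis using c by (auto simp: desc_Nil)
      next
        case (Some d)
        then have "\<not> desc c0 d" using False desc_iff_below by blast
        then show ?thesis using c Some by (auto simp: desc_child)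
      qed
    qed
    then have "curl ?a t = 0"
      unfolding curl_def by (intro sum.neutral ballI) (simp only: mult_zero_right)
    ultimately show ?thesis by simp
  qed
qed

end

text \<open>The factor \<open>1 / sqrt 2 ^ k\<close> compensates for the doubling of triangles at
  each depth: it symmetrises the recurrence to
  \<open>x (k-1) + x (k+1) = 2 * cos \<theta> * x k\<close>, solved by sines.\<close>

lemma sine_recurrence:
  fixes \<theta> :: real
  defines "\<phi> \<equiv> \<lambda>k. sin (real k * \<theta>) / sqrt 2 ^ k"
  shows "3/2 * \<phi> (Suc k) - \<phi> k / 2 - \<phi> (Suc (Suc k)) = (3/2 - sqrt 2 * cos \<theta>) * \<phi> (Suc k)"
proof -
  define x where "x = real (Suc k) * \<theta>"
  have k: "real k * \<theta> = x - \<theta>" "real (Suc (Suc k)) * \<theta> = x + \<theta>" by (simp_all add: x_def algebra_simps)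
  have "sin (x - \<theta>) + sin (x + \<theta>) = 2 * cos \<theta> * sin x" by (simp add: sin_add sin_diff)
  moreover have "\<phi> k / 2 + \<phi> (Suc (Suc k)) = (sin (x - \<theta>) + sin (x + \<theta>)) / (2 * sqrt 2 ^ k)"
    unfolding \<phi>_def k by (simp add: field_simps)
  moreover have "sqrt 2 * \<phi> (Suc k) = sin x / sqrt 2 ^ k" unfolding \<phi>_def x_def by simp
  ultimately have "\<phi> k / 2 + \<phi> (Suc (Suc k)) = cos \<theta> * (sqrt 2 * \<phi> (Suc k))" by simp
  then show ?thesis by (simp add: algebra_simps)
qed

text \<open>The equation is the boundary condition \<open>\<phi> (m+1) = - \<phi> m\<close>. At
  either end of the interval one of the two sines vanishes and the other has a definite sign, so the
  intermediate value theorem applies.\<close>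

lemma angle_exists:
  assumes "m \<ge> 1"
  obtains \<theta> where "pi / real (Suc m) \<le> \<theta>" "\<theta> \<le> pi / real m" "sin (real (Suc m) * \<theta>) = - sqrt 2 * sin (real m * \<theta>)"
proof -
  define F where "F \<theta> = sin (real (Suc m) * \<theta>) + sqrt 2 * sin (real m * \<theta>)" for \<theta>
  have "\<exists>\<theta>\<ge>pi / real (Suc m). \<theta> \<le> pi / real m \<and> F \<theta> = 0"
  proof (rule IVT2')
    have "real m * (pi / real (Suc m)) = pi - pi / real (Suc m)" by (simp add: field_simps)
    then have "sin (real m * (pi / real (Suc m))) = sin (pi / real (Suc m))" by simp
    moreover have "sin (pi / real (Suc m)) \<ge> 0" by (rule sin_ge_zero) (auto simp: field_simps)
    ultimately show "0 \<le> F (pi / real (Suc m))" by (simp add: F_def)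
    have "real (Suc m) * (pi / real m) = pi / real m + pi" using assms by (simp add: field_simps)
    then have "sin (real (Suc m) * (pi / real m)) = - sin (pi / real m)" by (simp only: sin_periodic_pi)
    moreover have "sin (pi / real m) \<ge> 0" using assms by (intro sin_ge_zero) (auto simp: field_simps)
    ultimately show "F (pi / real m) \<le> 0" using assms by (simp add: F_def)
    show "pi / real (Suc m) \<le> pi / real m" using assms by (intro divide_left_mono) auto
    show "continuous_on {pi / real (Suc m)..pi / real m} F" unfolding F_def by (intro continuous_intros)
  qed
  then show thesis using that by (auto simp: F_def)
qed

lemma spectral_gap_ball:
  assumes c0: "c0 \<in> codes" and m: "m \<ge> 2"
  shows "3/2 - sqrt 2 \<le> spectral_gap (ball T22 (edge c0) (Suc m))"
    "spectral_gap (ball T22 (edge c0) (Suc m)) \<le> 3/2 - sqrt 2 * cos (pi / real m)"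
proof -
  let ?X = "ball T22 (edge c0) (Suc m)"
  interpret finite_subcomplex ?X by (rule finite_subcomplex_ball[OF c0]) simp
  obtain \<theta> where th: "pi / real (Suc m) \<le> \<theta>" "\<theta> \<le> pi / real m" 
    "sin (real (Suc m) * \<theta>) = - sqrt 2 * sin (real m * \<theta>)" using angle_exists[of m] m by auto
  define \<mu> where "\<mu> = 3/2 - sqrt 2 * cos \<theta>"
  define \<phi> where "\<phi> = (\<lambda>k. sin (real k * \<theta>) / sqrt 2 ^ k)"
  have "0 < pi / real (Suc m)" by simp
  then have pos: "0 < \<theta>" using th(1) by linarith
  have "pi / real m \<le> pi / 2" using m by (intro divide_left_mono) auto
  then have lt: "\<theta> < pi" using th(2) pi_gt_zero by linarith
  have s2: "sqrt 2 < 3/2" by (rule real_less_lsqrt) (auto simp: power2_eq_square)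
  have "sqrt 2 * cos \<theta> \<le> sqrt 2 * 1" by (intro mult_left_mono) auto
  then have mu0: "\<mu> \<noteq> 0" using s2 unfolding \<mu>_def by linarith
  have \<phi>0: "\<phi> 0 = 0" by (simp add: \<phi>_def)
  have rec: "3/2 * \<phi> (Suc k) - \<phi> k / 2 - \<phi> (Suc (Suc k)) = \<mu> * \<phi> (Suc k)" for k
    unfolding \<phi>_def \<mu>_def by (rule sine_recurrence)
  have bnd: "\<phi> (Suc m) = - \<phi> (Suc m - 1)"
    using th(3) by (simp add: \<phi>_def del: of_nat_Suc)
  have in_spec: "\<mu> \<in> spec_Z1 ?X"
  \<comment> \<open>A triangle of depth 1 witnesses that the eigenfunction is nonzero: its value is
    \<open>sin \<theta> / sqrt 2\<close>, positive as \<theta> lies strictly between 0 and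
    pi.\<close>
  proof (rule eigenvalue_in_spec[where h = "radial \<phi> c0" and t = "Some (below c0 [True])"])
    fix t assume "t \<in> fcodes ?X"
    then show "curl (\<lambda>c. bdry ?X (radial \<phi> c0) c / cdeg ?X c) t = \<mu> * radial \<phi> c0 t"
      using m \<phi>0 rec bnd by (intro radial_eigen[OF c0]) simp_all
  next
    show "Some (below c0 [True]) \<in> fcodes ?X" using below_fcodes[OF c0] m by simp
    have "sin \<theta> > 0" using pos lt by (rule sin_gt_zero)
    then show "radial \<phi> c0 (Some (below c0 [True])) \<noteq> 0" by (simp add: \<phi>_def)
  qed (rule mu0)
  show "3/2 - sqrt 2 \<le> spectral_gap ?X" unfolding spectral_gap_def
    using in_spec spec_lower by (intro cInf_greatest) auto
  have "spectral_gap ?X \<le> \<mu>" unfolding spectral_gap_def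
    using in_spec spec_lower by (intro cInf_lower bdd_belowI) auto
  also have "cos (pi / real m) \<le> cos \<theta>" using th(2) pos m
    by (intro cos_monotone_0_pi_le) (auto simp: field_simps)
  then have "\<mu> \<le> 3/2 - sqrt 2 * cos (pi / real m)" by (simp add: \<mu>_def)
  finally show "spectral_gap ?X \<le> 3/2 - sqrt 2 * cos (pi / real m)" .
qed

theorem mainTheorem11:
  fixes e0 :: "vert set"
  assumes "e0 \<in> cells T22 1"
  shows "((\<lambda>r. spectral_gap (ball T22 e0 r)) \<longlonglongrightarrow> 3/2 - sqrt 2)
    \<and> spectral_gap T22 = 0
    \<and> (\<forall>R. eventually (\<lambda>r. ball (ball T22 e0 r) e0 R = ball T22 e0 R) sequentially)
    \<and> liminf (\<lambda>r. ereal (spectral_gap (ball T22 e0 r))) > ereal (spectral_gap T22)"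
proof -
  obtain c0 where c0: "c0 \<in> codes" "e0 = edge c0" using assms cells_T22_1 by auto
  have "(\<lambda>m. spectral_gap (ball T22 e0 (Suc m))) \<longlonglongrightarrow> 3/2 - sqrt 2"
  proof (rule tendsto_sandwich)
    show "\<forall>\<^sub>F m in sequentially. 3/2 - sqrt 2 \<le> spectral_gap (ball T22 e0 (Suc m))"
      using eventually_ge_at_top[of 2] by eventually_elim (use spectral_gap_ball[OF c0(1)] c0(2) in simp)
    show "\<forall>\<^sub>F m in sequentially. spectral_gap (ball T22 e0 (Suc m)) \<le> 3/2 - sqrt 2 * cos (pi / real m)"
      using eventually_ge_at_top[of 2] by eventually_elim (use spectral_gap_ball[OF c0(1)] c0(2) in simp)
    have "(\<lambda>m. 3/2 - sqrt 2 * cos (pi / real m)) \<longlonglongrightarrow> 3/2 - sqrt 2 * cos 0"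
      by (intro tendsto_intros lim_const_over_n)
    then show "(\<lambda>m. 3/2 - sqrt 2 * cos (pi / real m)) \<longlonglongrightarrow> 3/2 - sqrt 2" by simp
  qed simp
  then have lim: "(\<lambda>r. spectral_gap (ball T22 e0 r)) \<longlonglongrightarrow> 3/2 - sqrt 2"
    by (rule LIMSEQ_imp_Suc)
  have "sqrt 2 < 3/2" by (rule real_less_lsqrt) (auto simp: power2_eq_square)
  moreover have "liminf (\<lambda>r. ereal (spectral_gap (ball T22 e0 r))) = ereal (3/2 - sqrt 2)"
    by (rule lim_imp_Liminf) (use lim in \<open>simp_all add: tendsto_ereal\<close>)
  ultimately have "liminf (\<lambda>r. ereal (spectral_gap (ball T22 e0 r))) > ereal (spectral_gap T22)"
    by (simp add: spectral_gap_T22)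
  moreover have "\<forall>\<^sub>F r in sequentially. ball (ball T22 e0 r) e0 k = ball T22 e0 k" for k
    using eventually_ge_at_top[of k] by eventually_elim (rule ball_ball[OF T22_down assms])
  ultimately show ?thesis using lim spectral_gap_T22 by blast
qed

end
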